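(* Let $T$ and $E$ be extended pseudo-metric spaces with $E$ complete. Suppose that $T$ can be covered by an increasing sequence of totally bounded open subsets $(T_n)_{n\in\mathbb N}$ such that each $T_n$ has bounded covering number with constant $c_n>0$ and exponent $d>0$ (the same exponent for all $n$). Let $(p_m,q_m)_{m\in\mathbb N}$ be a sequence of pairs of positive numbers such that $q_m>d$ for all $m\in\mathbb N$. Let $(X_t)_{t\in T}$ be a stochastic process with values in $E$ that, for every $m\in\mathbb N$, satisfies the Kolmogorov condition with exponents $(p_m,q_m)$ (for some finite constant $M_m$). Then $X$ has a modification $Y$ such that the paths of $Y$ are locally Hölder continuous of all orders $\gamma\in\left(0,\sup_m\frac{q_m-d}{p_m}\right)$.
   Context: An extended pseudo-metric is a symmetric function $d$ with values in $[0,+\infty]$ with $d(x,x)=0$ satisfying the triangle inequality (distinct points may have distance $0$). Denote the distances on $T,E$ by $d_T,d_E$. $E$ carries its Borel $\sigma$-algebra; processes are defined on a probability space $(\Omega,\mathcal F,P)$. For a set $S\subseteq T$ and $\varepsilon>0$, an $\varepsilon$-cover of $S$ is a subset $C\subseteq S$ such that every $t\in S$ has some $s\in C$ with $d_T(s,t)\le\varepsilon$; $N_\varepsilon(S)$ is the minimal cardinality of an $\varepsilon$-cover of $S$. $S$ has bounded covering number with constant $c>0$ and exponent $d\ge0$ if $N_\varepsilon(S)\le c\,\varepsilon^{-d}$ for all $\varepsilon\in(0,\mathrm{diam}(S)]$. The process $(X_t)_{t\in T}$ satisfies the Kolmogorov condition for exponents $(p,q)$ with constant $M\ge0$ (real)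 if for all $s,t\in T$ the pair $(X_s,X_t):\Omega\to E\times E$ is measurable for the Borel $\sigma$-algebra on $E\times E$ and $\mathbf E[d_E(X_s,X_t)^p]\le M\,d_T(s,t)^q$. A modification of $X$ is a process $Y$ with each $Y_t$ measurable and $X_t=Y_t$ almost surely for every $t\in T$. A function $f:T\to E$ is locally Hölder continuous of order $\gamma$ if every $t\in T$ has a neighborhood $U$ and a finite constant $C$ with $d_E(f(r),f(s))\le C\,d_T(r,s)^\gamma$ for all $r,s\in U$. The supremum may be $+\infty$. *)

theory Defs
  imports "HOL-Probability.Probability"
begin

section \<open>Extended pseudo-metric spaces\<close>

text \<open>
  The development mirrors the library locale \<^locale>\<open>Metric_space\<close>: the space is a carrier
  set \<open>S\<close> together with a distance function whose values outside the carrier are irrelevant.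
\<close>

locale Ext_pseudo_metric =
  fixes S :: "'a set" and d :: "'a \<Rightarrow> 'a \<Rightarrow> ennreal"
  assumes refl: "\<And>x. x \<in> S \<Longrightarrow> d x x = 0"
    and commute: "\<And>x y. \<lbrakk>x \<in> S; y \<in> S\<rbrakk> \<Longrightarrow> d x y = d y x"
    and triangle: "\<And>x y z. \<lbrakk>x \<in> S; y \<in> S; z \<in> S\<rbrakk> \<Longrightarrow> d x z \<le> d x y + d y z"
begin

definition mball :: "'a \<Rightarrow> ennreal \<Rightarrow> 'a set"
  where "mball x r = {y. x \<in> S \<and> y \<in> S \<and> d x y < r}"

definition mopen :: "'a set \<Rightarrow> bool"
  where "mopen U \<longleftrightarrow> U \<subseteq> S \<and> (\<forall>x\<in>U. \<exists>r>0. mball x r \<subseteq> U)"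

definition mtopology :: "'a topology"
  where "mtopology = topology mopen"

lemma istopology_mopen: "istopology mopen"
proof -
  have "mopen (U \<inter> V)" if U: "mopen U" and V: "mopen V" for U V
    unfolding mopen_def
  proof (intro conjI ballI)
    show "U \<inter> V \<subseteq> S" using U by (auto simp: mopen_def)
    fix x assume "x \<in> U \<inter> V"
    then obtain r r' where r: "r > 0" "mball x r \<subseteq> U" "r' > 0" "mball x r' \<subseteq> V"
      using U V unfolding mopen_def by blast
    then have "min r r' > 0" "mball x (min r r') \<subseteq> U \<inter> V"
      by (simp_all add: mball_def subset_iff)
    then show "\<exists>s>0. mball x s \<subseteq> U \<inter> V" by blast
  qed
  moreover have "mopen (\<Union>\<K>)" if opens: "\<forall>K\<in>\<K>. mopen K" for \<K>
    unfolding mopen_def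
  proof (intro conjI ballI)
    show "\<Union>\<K> \<subseteq> S" using opens by (auto simp: mopen_def)
    fix x assume "x \<in> \<Union>\<K>"
    then obtain K where K: "K \<in> \<K>" "x \<in> K" by (rule UnionE)
    then obtain r where "r > 0" "mball x r \<subseteq> K"
      using opens unfolding mopen_def by meson
    then show "\<exists>r>0. mball x r \<subseteq> \<Union>\<K>"
      using K by (meson Union_upper order_trans)
  qed
  ultimately show ?thesis by (simp add: istopology_def)
qed

lemma openin_mtopology:
  "openin mtopology U \<longleftrightarrow> U \<subseteq> S \<and> (\<forall>x\<in>U. \<exists>r>0. mball x r \<subseteq> U)"
  unfolding mtopology_def topology_inverse'[OF istopology_mopen] mopen_def ..

lemma topspace_mtopology [simp]: "topspace mtopology = S"
proof (rule antisym)
  have "openin mtopology S"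
    unfolding openin_mtopology mball_def by (auto intro: exI[of _ 1])
  then show "S \<subseteq> topspace mtopology" by (rule openin_subset)
  show "topspace mtopology \<subseteq> S" 
    using openin_topspace[of mtopology] unfolding openin_mtopology by (rule conjunct1)
qed

definition MCauchy :: "(nat \<Rightarrow> 'a) \<Rightarrow> bool"
  where "MCauchy \<sigma> \<longleftrightarrow>
    range \<sigma> \<subseteq> S \<and> (\<forall>\<epsilon>>0. \<exists>N. \<forall>n\<ge>N. \<forall>n'\<ge>N. d (\<sigma> n) (\<sigma> n') < \<epsilon>)"

definition mcomplete :: bool
  where "mcomplete \<longleftrightarrow> (\<forall>\<sigma>. MCauchy \<sigma> \<longrightarrow> (\<exists>x. limitin mtopology \<sigma> x sequentially))"

definition mtotally_bounded :: "'a set \<Rightarrow> bool"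
  where "mtotally_bounded A \<longleftrightarrow>
    (\<forall>\<epsilon>>0. \<exists>K. finite K \<and> K \<subseteq> A \<and> A \<subseteq> (\<Union>x\<in>K. mball x \<epsilon>))"

end

section \<open>Powers, diameter and covering numbers\<close>

text \<open>
  Powers of extended nonnegative reals with real exponent \<open>r \<ge> 0\<close> (negative exponents are not
  used): \<open>0 ^ r = 0\<close> and \<open>\<infinity> ^ r = \<infinity>\<close> for \<open>r > 0\<close>, and \<open>x ^ 0 = 1\<close> for every \<open>x\<close>; the
  last equation fails for \<^const>\<open>powr\<close> at \<open>x = 0\<close>.
\<close>

definition epowr :: "ennreal \<Rightarrow> real \<Rightarrow> ennreal"  (infixr "epowr" 80)
  where "x epowr r =
    (if r = 0 then 1 else if x = \<infinity> then \<infinity> else ennreal (enn2real x powr r))"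

definition ediam :: "('a \<Rightarrow> 'a \<Rightarrow> ennreal) \<Rightarrow> 'a set \<Rightarrow> ennreal"
  where "ediam d A = (SUP x\<in>A. SUP y\<in>A. d x y)"

definition is_cover :: "('a \<Rightarrow> 'a \<Rightarrow> ennreal) \<Rightarrow> ennreal \<Rightarrow> 'a set \<Rightarrow> 'a set \<Rightarrow> bool"
  where "is_cover d \<epsilon> A C \<longleftrightarrow> C \<subseteq> A \<and> (\<forall>t\<in>A. \<exists>s\<in>C. d s t \<le> \<epsilon>)"

definition covering_number :: "('a \<Rightarrow> 'a \<Rightarrow> ennreal) \<Rightarrow> ennreal \<Rightarrow> 'a set \<Rightarrow> enat"
  where "covering_number d \<epsilon> A =
    (INF C\<in>{C. is_cover d \<epsilon> A C}. if finite C then enat (card C) else \<infinity>)"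

text \<open>
  Here \<open>\<epsilon>\<close> ranges over extended reals, so \<open>\<epsilon> = \<infinity>\<close> is included when the diameter is infinite.
  The power \<open>\<epsilon> ^ (-e)\<close> is written as \<open>(1 / \<epsilon>) ^ e\<close>.
\<close>

definition bounded_covering_number ::
    "('a \<Rightarrow> 'a \<Rightarrow> ennreal) \<Rightarrow> 'a set \<Rightarrow> real \<Rightarrow> real \<Rightarrow> bool"
  where "bounded_covering_number d A c e \<longleftrightarrow>
    (\<forall>\<epsilon>. 0 < \<epsilon> \<and> \<epsilon> \<le> ediam d A \<longrightarrow>
       ennreal_of_enat (covering_number d \<epsilon> A) \<le> ennreal c * (inverse \<epsilon> epowr e))"

section \<open>Stochastic processes\<close>

definition borel_of :: "'a topology \<Rightarrow> 'a measure"
  where "borel_of \<T> = sigma (topspace \<T>) {U. openin \<T> U}"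

definition stochastic_process ::
    "'w measure \<Rightarrow> 't set \<Rightarrow> 'e measure \<Rightarrow> ('t \<Rightarrow> 'w \<Rightarrow> 'e) \<Rightarrow> bool"
  where "stochastic_process P T N X \<longleftrightarrow> (\<forall>t\<in>T. X t \<in> measurable P N)"

text \<open>
  Measurability of the pair is with respect to the Borel sets of the product topology, which may
  be more numerous than the product \<open>\<sigma>\<close>-algebra. In the moment bound, \<open>0 * \<infinity> = 0\<close>.
\<close>

definition kolmogorov_condition ::
    "'w measure \<Rightarrow> 't set \<Rightarrow> ('t \<Rightarrow> 't \<Rightarrow> ennreal) \<Rightarrow> 'e set \<Rightarrow> ('e \<Rightarrow> 'e \<Rightarrow> ennreal) \<Rightarrow>
     ('t \<Rightarrow> 'w \<Rightarrow> 'e) \<Rightarrow> real \<Rightarrow> real \<Rightarrow> real \<Rightarrow> bool"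
  where "kolmogorov_condition P T dT E dE X p q M \<longleftrightarrow>
    (\<forall>s\<in>T. \<forall>t\<in>T.
      (\<lambda>\<omega>. (X s \<omega>, X t \<omega>)) \<in> measurable P
         (borel_of (prod_topology (Ext_pseudo_metric.mtopology E dE)
                                  (Ext_pseudo_metric.mtopology E dE))) \<and>
      (\<integral>\<^sup>+\<omega>. dE (X s \<omega>) (X t \<omega>) epowr p \<partial>P) \<le> ennreal M * (dT s t epowr q))"

definition modification ::
    "'w measure \<Rightarrow> 't set \<Rightarrow> 'e measure \<Rightarrow> ('t \<Rightarrow> 'w \<Rightarrow> 'e) \<Rightarrow> ('t \<Rightarrow> 'w \<Rightarrow> 'e) \<Rightarrow> bool"
  where "modification P T N X Y \<longleftrightarrow>
    stochastic_process P T N Y \<and> (\<forall>t\<in>T. AE \<omega> in P. X t \<omega> = Y t \<omega>)"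

definition locally_holder ::
    "'t set \<Rightarrow> ('t \<Rightarrow> 't \<Rightarrow> ennreal) \<Rightarrow> ('e \<Rightarrow> 'e \<Rightarrow> ennreal) \<Rightarrow> real \<Rightarrow> ('t \<Rightarrow> 'e) \<Rightarrow> bool"
  where "locally_holder T dT dE \<gamma> f \<longleftrightarrow>
    (\<forall>t\<in>T. \<exists>U C. openin (Ext_pseudo_metric.mtopology T dT) U \<and> t \<in> U \<and> 0 \<le> C \<and>
       (\<forall>r\<in>U. \<forall>s\<in>U. dE (f r) (f s) \<le> ennreal C * (dT r s epowr \<gamma>)))"

end

(* Along dyadic nets V_k of cardinality at most a^(k + k0), a = 2^d, one wants to control the
   increments of X over all pairs of V_k at distance of order 2^-k. A union bound over these pairs
   would require q > 2d, because there may be quadratically many of them. Talagrand's pair reduction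
   replaces them by at most a |V_k| pairs at distance of order k 2^-k, which dominate all the others
   through a common third point; the polynomial factor k^q is harmless. Summing weighted p-th moments
   then bounds all these increments by a random multiple of 2^(-gamma k), and chaining turns this into
   a Hoelder estimate on a countable dense set D. Doing so for countably many orders gamma and all
   T_n at once, Y is the limit of X along points of D, except that Y_t is X_t itself wherever X_t is
   such a limit: in a pseudo-metric space limits are not unique. *)
theory Submission
  imports Defs "HOL-Real_Asymp.Real_Asymp"
begin

section \<open>Extended pseudo-metric spaces\<close>

text \<open>The admissible orders come from a count of exponents. After pair reduction, level k
  keeps at most a constant times a^k pairs, with p-th moments of order (k 2^-k)^q. Weighted by
  2^(gamma p k), they contribute of order k^q 2^((d + gamma p - q) k), which is summable when gamma
  < (q - d)/p.

  Three obstacles shape the rest. Distances may be infinite, so regularity is only claimed at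
  distances at most 1, which is enough locally. Each T_n brings its own nets, while Y must not
  depend on n: chaining therefore does not ask the points of D to be net points, only that the
  values along the nets converge to the values on D. Finally, one null set has to serve uncountably
  many orders: rational ones suffice, because at small distances a Hoelder bound of larger order
  implies the bound of smaller order.\<close>

lemma ennreal_add_strict_mono:
  fixes a b c d :: ennreal
  assumes "a < b" "c < d"
  shows "a + c < b + d"
proof -
  have "a + c < a + d" using assms by (auto simp: ennreal_add_left_cancel_less)
  also have "\<dots> \<le> b + d" using assms by (intro add_right_mono) simp
  finally show ?thesis .
qed

context Ext_pseudo_metric
begin

lemma openin_mball: "openin mtopology (mball x r)"
  unfolding openin_mtopology
proof (intro conjI ballI)
  show "mball x r \<subseteq> S" by (auto simp: mball_def)
  fix y assume "y \<in> mball x r"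
  then have y: "x \<in> S" "y \<in> S" "d x y < r" by (auto simp: mball_def)
  have "mball y (r - d x y) \<subseteq> mball x r"
  proof
    fix z assume "z \<in> mball y (r - d x y)"
    then have z: "z \<in> S" "d y z < r - d x y" by (auto simp: mball_def)
    have "d x z \<le> d x y + d y z" using y z by (intro triangle)
    also have "\<dots> < d x y + (r - d x y)"
      using y(3) z by (auto simp: ennreal_add_left_cancel_less)
    also have "\<dots> = r" using y(3) by (simp add: add_diff_self_ennreal less_imp_le)
    finally show "z \<in> mball x r" using y z by (simp add: mball_def)
  qed
  then show "\<exists>e>0. mball y e \<subseteq> mball x r" using y by (auto intro: diff_gr0_ennreal)
qed

lemma mem_mball_self: "x \<in> S \<Longrightarrow> 0 < r \<Longrightarrow> x \<in> mball x r"
  by (simp add: mball_def refl)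

lemma limitin_imp_tendsto:
  assumes "range f \<subseteq> S" and "limitin mtopology f x sequentially"
  shows "(\<lambda>k. d (f k) x) \<longlonglongrightarrow> 0"
proof (rule order_tendstoI)
  fix e :: ennreal assume e: "0 < e"
  have x: "x \<in> S" using assms(2) by (simp add: limitin_def)
  then have "x \<in> mball x e" using e by (simp add: mball_def refl)
  then have "eventually (\<lambda>k. f k \<in> mball x e) sequentially"
    using assms(2) openin_mball by (simp add: limitin_def)
  then show "eventually (\<lambda>k. d (f k) x < e) sequentially"
    by eventually_elim (auto simp: mball_def commute)
qed auto

text \<open>Replaces continuity of the distance: limits are not unique here, so convergence is
  expressed by distances to a chosen limit point, and the triangle inequality through
  \<open>f k\<close> and \<open>g k\<close> does the rest.\<close>

lemma dist_le_of_tendsto: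
  assumes "range f \<subseteq> S" "range g \<subseteq> S" "x \<in> S" "y \<in> S"
    and lim: "(\<lambda>k. d (f k) x) \<longlonglongrightarrow> 0" "(\<lambda>k. d (g k) y) \<longlonglongrightarrow> 0"
    and le: "eventually (\<lambda>k. d (f k) (g k) \<le> b) sequentially"
  shows "d x y \<le> b"
proof (rule tendsto_lowerbound)
  show "(\<lambda>k. d (f k) x + b + d (g k) y) \<longlonglongrightarrow> b"
    using tendsto_add[OF tendsto_add[OF lim(1) tendsto_const[of b]] lim(2)] by simp
  show "eventually (\<lambda>k. d x y \<le> d (f k) x + b + d (g k) y) sequentially"
    using le
  proof eventually_elim
    case (elim k)
    have S: "f k \<in> S" "g k \<in> S" using assms by auto
    have "d x y \<le> d x (f k) + d (f k) y" using assms S by (intro triangle)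
    also have "d (f k) y \<le> d (f k) (g k) + d (g k) y" using assms S by (intro triangle)
    finally show ?case
      using elim assms S by (simp add: commute[of x] add.assoc) (meson add_left_mono add_right_mono order_trans)
  qed
qed simp

lemma openin_dist_less:
  "openin (prod_topology mtopology mtopology) {z \<in> S \<times> S. d (fst z) (snd z) < a}"
  unfolding openin_prod_topology_alt
proof (intro allI impI)
  fix x y assume "(x, y) \<in> {z \<in> S \<times> S. d (fst z) (snd z) < a}"
  then have xy: "x \<in> S" "y \<in> S" "d x y < a" by auto
  \<comment> \<open>Moving each of the two points by less than half of the slack keeps their
    distance below \<open>a\<close>.\<close>
  define e where "e = (a - d x y) / 2"
  have ee: "e + e = a - d x y"
    by (simp add: e_def mult_2_right[symmetric] ennreal_divide_times)
  have "0 < e" using diff_gr0_ennreal[OF xy(3)] by (simp add: e_def ennreal_zero_less_divide)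
  have "mball x e \<times> mball y e \<subseteq> {z \<in> S \<times> S. d (fst z) (snd z) < a}"
  proof clarsimp
    fix u v assume "u \<in> mball x e" "v \<in> mball y e"
    then have uv: "u \<in> S" "v \<in> S" "d x u < e" "d y v < e" by (auto simp: mball_def)
    have "d u v \<le> d u x + d x v" using xy uv by (intro triangle)
    also have "d x v \<le> d x y + d y v" using xy uv by (intro triangle)
    also have "d u x + (d x y + d y v) = d x y + (d x u + d y v)"
      using xy uv by (simp add: commute[of u x] ac_simps)
    also have "\<dots> < d x y + (e + e)"
      using xy(3) uv by (auto simp: ennreal_add_left_cancel_less ennreal_add_strict_mono)
    also have "\<dots> = a" using xy(3) by (simp add: ee add_diff_self_ennreal less_imp_le)
    finally show "u \<in> S \<and> v \<in> S \<and> d u v < a" using uv by (auto simp: add_left_mono)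
  qed
  then show "\<exists>U V. openin mtopology U \<and> openin mtopology V \<and> x \<in> U \<and> y \<in> V \<and>
      U \<times> V \<subseteq> {z \<in> S \<times> S. d (fst z) (snd z) < a}"
    using xy(1,2) \<open>0 < e\<close> openin_mball mem_mball_self by meson
qed

end

section \<open>Borel sets, measurability of distances and of pointwise limits\<close>

lemma open_subsets_topspace: "{U. openin \<T> U} \<subseteq> Pow (topspace \<T>)"
  by (auto dest: openin_subset)

lemma space_borel_of [simp]: "space (borel_of \<T>) = topspace \<T>"
  unfolding borel_of_def by (simp add: open_subsets_topspace)

lemma openin_in_sets_borel_of: "openin \<T> U \<Longrightarrow> U \<in> sets (borel_of \<T>)"
  unfolding borel_of_def by (simp add: open_subsets_topspace)

lemma measurable_borel_ofI:
  assumes "f \<in> space M \<rightarrow> topspace \<T>"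
    and "\<And>U. openin \<T> U \<Longrightarrow> f -` U \<inter> space M \<in> sets M"
  shows "f \<in> measurable M (borel_of \<T>)"
  unfolding borel_of_def using assms by (intro measurable_measure_of open_subsets_topspace) auto

context Ext_pseudo_metric
begin

text \<open>The sets where the distance is below \<open>a\<close> are open in the product topology
  but may lie outside the product sigma-algebra. This is why the pair, and not just each component,
  is assumed measurable.\<close>

lemma measurable_dist:
  assumes "(\<lambda>\<omega>. (f \<omega>, g \<omega>)) \<in> measurable M (borel_of (prod_topology mtopology mtopology))"
  shows "(\<lambda>\<omega>. d (f \<omega>) (g \<omega>)) \<in> borel_measurable M"
proof (rule borel_measurableI_less)
  fix a :: ennreal
  have "f \<omega> \<in> S \<and> g \<omega> \<in> S" if "\<omega> \<in> space M" for \<omega>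
    using measurable_space[OF assms that] by simp
  then have "{\<omega> \<in> space M. d (f \<omega>) (g \<omega>) < a} =
      (\<lambda>\<omega>. (f \<omega>, g \<omega>)) -` {z \<in> S \<times> S. d (fst z) (snd z) < a} \<inter> space M"
    by auto
  then show "{\<omega> \<in> space M. d (f \<omega>) (g \<omega>) < a} \<in> sets M"
    using measurable_sets[OF assms openin_in_sets_borel_of[OF openin_dist_less]] by simp
qed

text \<open>An open set is exhausted from inside by open sets that keep a positive distance from its
  complement; the limit is in \<open>U\<close> iff the sequence is eventually in one of them. Any
  choice of limit point is allowed, since open sets do not separate points at distance 0.\<close>

lemma measurable_limit:
  assumes f: "\<And>k. f k \<in> measurable M (borel_of mtopology)"
    and g: "g \<in> space M \<rightarrow> S"
    and lim: "\<And>\<omega>. \<omega> \<in> space M \<Longrightarrow> (\<lambda>k. d (f k \<omega>) (g \<omega>)) \<longlonglongrightarrow> 0"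
  shows "g \<in> measurable M (borel_of mtopology)"
proof (rule measurable_borel_ofI)
  show "g \<in> space M \<rightarrow> topspace mtopology" using g by simp
  fix U assume U: "openin mtopology U"
  define h :: "nat \<Rightarrow> ennreal" where "h j = ennreal ((1/2) ^ j)" for j
  have hh: "h (Suc j) + h (Suc j) = h j" for j
    by (simp add: h_def ennreal_plus[symmetric] del: ennreal_plus)
  have h0: "h j > 0" for j by (simp add: h_def)
  \<comment> \<open>Every point closer than \<open>h (Suc j)\<close> to a point of
    \<open>W j\<close> is in \<open>U\<close>, because two radii \<open>h (Suc j)\<close> add up to
    \<open>h j\<close>.\<close>
  define W where "W j = (\<Union>x\<in>{x\<in>S. mball x (h j) \<subseteq> U}. mball x (h (Suc j)))" for j
  have W: "openin mtopology (W j)" for j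
    unfolding W_def by (intro openin_Union) (auto simp: openin_mball)
  have fS: "f k \<omega> \<in> S" if "\<omega> \<in> space M" for k \<omega>
    using measurable_space[OF f that] by simp
  have iff: "g \<omega> \<in> U \<longleftrightarrow> (\<exists>j N. \<forall>k\<in>{N..}. f k \<omega> \<in> W j)" if \<omega>: "\<omega> \<in> space M" for \<omega>
  proof
    assume gU: "g \<omega> \<in> U"
    then obtain r where r: "r > 0" "mball (g \<omega>) r \<subseteq> U"
      using U unfolding openin_mtopology by blast
    have "h \<longlonglongrightarrow> 0"
      unfolding h_def by (subst ennreal_tendsto_0_iff) (auto intro: LIMSEQ_realpow_zero)
    then have "eventually (\<lambda>j. h j < r) sequentially"
      using order_tendstoD(2) r(1) by blast
    then obtain j where "h j < r" by (auto simp: eventually_sequentially)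
    then have "mball (g \<omega>) (h j) \<subseteq> U" using r by (force simp: mball_def)
    then have sub: "mball (g \<omega>) (h (Suc j)) \<subseteq> W j" using g \<omega> by (auto simp: W_def)
    obtain N where N: "\<And>k. k \<ge> N \<Longrightarrow> d (f k \<omega>) (g \<omega>) < h (Suc j)"
      using order_tendstoD(2)[OF lim[OF \<omega>] h0] by (force simp: eventually_sequentially)
    have "f k \<omega> \<in> W j" if "k \<ge> N" for k
    proof -
      have "g \<omega> \<in> S" using g \<omega> by auto
      then have "f k \<omega> \<in> mball (g \<omega>) (h (Suc j))"
        using N[OF that] fS[OF \<omega>] commute[of "g \<omega>" "f k \<omega>"] by (simp add: mball_def)
      then show ?thesis using sub by blast
    qed
    then show "\<exists>j N. \<forall>k\<in>{N..}. f k \<omega> \<in> W j" by fastforce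
  next
    assume "\<exists>j N. \<forall>k\<in>{N..}. f k \<omega> \<in> W j"
    then obtain j N where N: "\<And>k. k \<ge> N \<Longrightarrow> f k \<omega> \<in> W j" by auto
    obtain N' where "\<And>k. k \<ge> N' \<Longrightarrow> d (f k \<omega>) (g \<omega>) < h (Suc j)"
      using order_tendstoD(2)[OF lim[OF \<omega>] h0] by (force simp: eventually_sequentially)
    then have close: "d (f (max N N') \<omega>) (g \<omega>) < h (Suc j)" by simp
    obtain x where x: "x \<in> S" "mball x (h j) \<subseteq> U" "d x (f (max N N') \<omega>) < h (Suc j)"
      using N[of "max N N'"] by (auto simp: W_def mball_def)
    have "d x (g \<omega>) \<le> d x (f (max N N') \<omega>) + d (f (max N N') \<omega>) (g \<omega>)"
      using x fS[OF \<omega>] g \<omega> by (intro triangle) auto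
    also have "\<dots> < h (Suc j) + h (Suc j)" using x(3) close by (rule ennreal_add_strict_mono)
    finally show "g \<omega> \<in> U" using x g \<omega> by (auto simp: hh mball_def)
  qed
  have "g -` U \<inter> space M = {\<omega> \<in> space M. \<exists>j N. \<forall>k\<in>{N..}. f k \<omega> \<in> W j}"
    using iff by blast
  also have "\<dots> = (\<Union>j. \<Union>N. \<Inter>k\<in>{N..}. f k -` W j \<inter> space M)" by fastforce
  also have "\<dots> \<in> sets M"
  proof -
    have "f k -` W j \<inter> space M \<in> sets M" for k j
      using measurable_sets[OF f openin_in_sets_borel_of[OF W]] .
    then have "(\<Inter>k\<in>{N..}. f k -` W j \<inter> space M) \<in> sets M" for j N
      by (intro sets.countable_INT') (simp_all add: image_subset_iff)
    then show ?thesis by (intro sets.countable_nat_UN image_subsetI)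
  qed
  finally show "g -` U \<inter> space M \<in> sets M" .
qed

end

section \<open>Pair reduction\<close>

text \<open>
  Greedy construction: for a point \<open>u\<close>, take the least \<open>r\<close> with at most \<open>a ^ (r + 1)\<close> points within
  \<open>(r + 1) * b\<close> of \<open>u\<close>, record the pairs of \<open>u\<close> with these points, and delete the points within
  \<open>r * b\<close>. By minimality at least \<open>a ^ r\<close> points are deleted, so each of them pays for at most \<open>a\<close>
  pairs. A pair at distance at most \<open>b\<close> is served by the \<open>u\<close> that deletes one of its points first.
\<close>

lemma pair_reduction:
  fixes d :: "'a \<Rightarrow> 'a \<Rightarrow> ennreal" and a :: real and b :: ennreal
  assumes tri: "Ext_pseudo_metric S d" and a: "1 \<le> a"
  shows "finite V \<Longrightarrow> V \<subseteq> S \<Longrightarrow> real (card V) \<le> a ^ n \<Longrightarrow>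
    \<exists>K \<subseteq> V \<times> V. real (card K) \<le> a * real (card V) \<and> (\<forall>s t. (s, t) \<in> K \<longrightarrow> d s t \<le> of_nat n * b) \<and>
      (\<forall>s\<in>V. \<forall>t\<in>V. d s t \<le> b \<longrightarrow> (\<exists>u\<in>V. (u, s) \<in> K \<and> (u, t) \<in> K))"
proof (induction "card V" arbitrary: V rule: less_induct)
  case less
  interpret Ext_pseudo_metric S d by (rule tri)
  show ?case
  proof (cases "V = {}")
    case True
    then show ?thesis by (intro exI[of _ "{}"]) auto
  next
    case False
    then obtain u where u: "u \<in> V" by blast
    then have uS: "u \<in> S" using less.prems by auto
    define B where "B r = {s \<in> V. d u s \<le> of_nat r * b}" for r
    have Bsub: "B r \<subseteq> V" "finite (B r)" for r
      using less.prems by (auto simp: B_def)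
    define r where "r = (LEAST r. real (card (B (Suc r))) \<le> a ^ Suc r)"
    have Bn: "real (card (B n)) \<le> a ^ n"
      using card_mono[OF less.prems(1) Bsub(1), of n] less.prems(3) by linarith
    have card1: "real (card (B 0)) \<ge> 1"
    proof -
      have "u \<in> B 0" using u uS by (simp add: B_def refl)
      then show ?thesis using Bsub(2)[of 0]
        by (metis One_nat_def Suc_leI card_gt_0_iff empty_iff of_nat_1 of_nat_le_iff)
    qed
    \<comment> \<open>The index \<open>n - 1\<close> always qualifies, since every \<open>B\<close>
      is a part of \<open>V\<close>. So \<open>r\<close> is well defined, and for positive
      \<open>n\<close> the recorded pairs stay within \<open>of_nat n * b\<close>.\<close>
    have ex: "real (card (B (Suc (n - 1)))) \<le> a ^ Suc (n - 1)"
    proof (cases n)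
      case 0
      have "card (B (Suc 0)) \<le> card V" using card_mono[OF less.prems(1) Bsub(1)] .
      then show ?thesis using 0 less.prems(3) a by simp
    next
      case (Suc m)
      then show ?thesis using Bn by simp
    qed
    have r: "real (card (B (Suc r))) \<le> a ^ Suc r"
      unfolding r_def by (rule LeastI[of "\<lambda>r. real (card (B (Suc r))) \<le> a ^ Suc r", OF ex])
    have r_le: "r \<le> n - 1"
      unfolding r_def by (rule Least_le[of "\<lambda>r. real (card (B (Suc r))) \<le> a ^ Suc r", OF ex])
    have r_lower: "a ^ r \<le> real (card (B r))"
    proof (cases r)
      case 0
      then show ?thesis using card1 by simp
    next
      case (Suc m)
      then have "\<not> real (card (B (Suc m))) \<le> a ^ Suc m"
        unfolding r_def using not_less_Least by (metis lessI)
      then show ?thesis using Suc by simp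
    qed
    \<comment> \<open>For \<open>n = 0\<close> the bound \<open>Suc r \<le> n\<close> is false, but
      then \<open>V\<close> is a single point.\<close>
    show ?thesis
    proof (cases "n = 0")
      case True
      then have "card V \<le> 1" using less.prems by simp
      then have V: "V = {u}" using u less.prems(1)
        by (metis card_le_Suc0_iff_eq is_singletonI' is_singleton_the_elem One_nat_def singletonD empty_iff)
      show ?thesis
        using a uS by (intro exI[of _ "{(u, u)}"]) (auto simp: V refl)
    next
      case n: False
      define V' where "V' = V - B r"
      have uB: "u \<in> B r" using u uS by (simp add: B_def refl)
      have less': "card V' < card V"
        unfolding V'_def using u uB less.prems(1) by (intro psubset_card_mono) auto
      have "real (card V') \<le> a ^ n" using less' less.prems(3) by linarith
      then obtain K' where K': "K' \<subseteq> V' \<times> V'" "real (card K') \<le> a * real (card V')"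
          "\<forall>s t. (s, t) \<in> K' \<longrightarrow> d s t \<le> of_nat n * b"
          "\<And>s t. s \<in> V' \<Longrightarrow> t \<in> V' \<Longrightarrow> d s t \<le> b \<Longrightarrow> \<exists>u\<in>V'. (u, s) \<in> K' \<and> (u, t) \<in> K'"
        using less.hyps[OF less'] less.prems by (force simp: V'_def)
      define K where "K = {u} \<times> B (Suc r) \<union> K'"
      have cardV: "real (card V) = real (card (B r)) + real (card V')"
        using card_Diff_subset[OF Bsub(2)[of r] Bsub(1)[of r]] card_mono[OF less.prems(1) Bsub(1)[of r]]
        by (simp add: V'_def)
      have "real (card K) \<le> real (card (B (Suc r))) + real (card K')"
        unfolding K_def by (metis card_Un_le card_cartesian_product_singleton of_nat_add of_nat_le_iff)
      also have "\<dots> \<le> a * a ^ r + a * real (card V')"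
        using r K'(2) by simp
      also have "\<dots> \<le> a * real (card (B r)) + a * real (card V')"
        using r_lower a by simp
      finally have card: "real (card K) \<le> a * real (card V)"
        by (simp add: cardV algebra_simps)
      \<comment> \<open>The recorded radius exceeds the deleted one by \<open>b\<close>, so it also
        reaches every point within \<open>b\<close> of a deleted point.\<close>
      have near: "(u, s) \<in> K \<and> (u, t) \<in> K"
        if "s \<in> V" "t \<in> V" "d s t \<le> b" "s \<in> B r" for s t
      proof -
        have "d u s \<le> of_nat r * b" using that by (simp add: B_def)
        then have "d u s \<le> of_nat (Suc r) * b"
          by (rule order_trans) (intro mult_right_mono, auto)
        moreover have "d u t \<le> of_nat (Suc r) * b"
        proof -
          have "d u t \<le> d u s + d s t" using that less.prems uS by (intro triangle) auto
          also have "\<dots> \<le> of_nat r * b + b" using that by (intro add_mono) (auto simp: B_def)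
          finally show ?thesis by (simp add: algebra_simps)
        qed
        ultimately show ?thesis using that by (auto simp: K_def B_def)
      qed
      have "\<exists>w\<in>V. (w, s) \<in> K \<and> (w, t) \<in> K" if "s \<in> V" "t \<in> V" "d s t \<le> b" for s t
      proof -
        have "d t s \<le> b" using that less.prems(2) commute by (metis subsetD)
        consider "s \<in> B r" | "t \<in> B r" | "s \<in> V'" "t \<in> V'"
          unfolding V'_def using \<open>s \<in> V\<close> \<open>t \<in> V\<close> by blast
        then show ?thesis
        proof cases
          case 1
          then show ?thesis using near[of s t] that u by blast
        next
          case 2
          then show ?thesis using near[of t s] that u \<open>d t s \<le> b\<close> by blast
        next
          case 3
          then show ?thesis using K'(4)[of s t] that by (auto simp: K_def V'_def)
        qed
      qed
      moreover have "d s t \<le> of_nat n * b" if "(s, t) \<in> K" for s t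
      proof -
        have "Suc r \<le> n" using n r_le by simp
        then have "of_nat (Suc r) * b \<le> of_nat n * b"
          by (intro mult_right_mono) (simp_all only: of_nat_le_iff zero_le)
        then show ?thesis using that K'(3) by (auto simp: K_def B_def intro: order_trans)
      qed
      moreover have "K \<subseteq> V \<times> V" using u K'(1) Bsub(1) by (auto simp: K_def V'_def)
      ultimately show ?thesis using card by (intro exI[of _ K]) auto
    qed
  qed
qed

lemma summable_poly_geometric:
  fixes q \<theta> k1 :: real
  assumes "0 < \<theta>" "\<theta> < 1"
  shows "summable (\<lambda>k. (real k + k1) powr q * \<theta> ^ k)"
proof (rule summable_comparison_test_bigo)
  show "summable (\<lambda>k. norm (1 / real k ^ 2))"
    using inverse_power_summable[of 2, where 'a = real] by (simp add: field_simps)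
  show "(\<lambda>k. (real k + k1) powr q * \<theta> ^ k) \<in> O(\<lambda>k. 1 / real k ^ 2)"
    using assms by real_asymp
qed

section \<open>Dyadic nets\<close>

lemma exists_dyadic_cover:
  assumes S: "Ext_pseudo_metric T dT" "S \<subseteq> T"
    and bcn: "bounded_covering_number dT S c e" and "0 < e"
  shows "\<exists>C. finite C \<and> is_cover dT (ennreal ((1/2) ^ k)) S C \<and>
    real (card C) \<le> max 1 c * (2 powr e) ^ k"
proof -
  interpret Ext_pseudo_metric T dT by (rule S)
  let ?\<epsilon> = "ennreal ((1/2) ^ k)"
  have pos: "(2 powr e) ^ k \<ge> 1"
    using \<open>0 < e\<close> by (intro one_le_power) (simp add: ge_one_powr_ge_zero)
  show ?thesis
  proof (cases "?\<epsilon> \<le> ediam dT S")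
    case True
    have inv: "inverse ?\<epsilon> epowr e = ennreal ((2 powr e) ^ k)"
    proof -
      have "inverse ?\<epsilon> = ennreal (2 ^ k)"
        by (subst inverse_ennreal) (simp_all add: power_one_over)
      then show ?thesis
        using \<open>0 < e\<close> by (simp add: epowr_def powr_realpow[symmetric] powr_powr mult.commute)
    qed
    have "ennreal_of_enat (covering_number dT ?\<epsilon> S) \<le> ennreal c * (inverse ?\<epsilon> epowr e)"
      using bcn True by (simp add: bounded_covering_number_def)
    also have "\<dots> \<le> ennreal (max 1 c * (2 powr e) ^ k)"
      using pos by (simp add: inv ennreal_mult' ennreal_mult'' mult_right_mono ennreal_leI)
    finally have le: "ennreal_of_enat (covering_number dT ?\<epsilon> S) \<le> ennreal (max 1 c * (2 powr e) ^ k)" .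
    \<comment> \<open>The infimum defining the covering number is attained because
      \<open>enat\<close> is well ordered; \<open>S\<close> itself shows that there is a cover at
      all.\<close>
    have "is_cover dT ?\<epsilon> S S"
      using S(2) by (auto simp: is_cover_def subset_iff refl intro!: bexI)
    then have "covering_number dT ?\<epsilon> S \<in>
        (\<lambda>C. if finite C then enat (card C) else \<infinity>) ` {C. is_cover dT ?\<epsilon> S C}"
      unfolding covering_number_def by (intro wellorder_InfI[OF imageI]) auto
    then obtain C where C: "is_cover dT ?\<epsilon> S C"
        "covering_number dT ?\<epsilon> S = (if finite C then enat (card C) else \<infinity>)" by blast
    then have fin: "finite C" using le by (auto split: if_splits simp: top_unique)
    then have "ennreal (real (card C)) \<le> ennreal (max 1 c * (2 powr e) ^ k)"
      using le C by (simp add: ennreal_of_nat_eq_real_of_nat)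
    then have "real (card C) \<le> max 1 c * (2 powr e) ^ k"
      by (rule ennreal_le_iff[THEN iffD1, rotated]) simp
    then show ?thesis using C fin by blast
  next
    case False
    \<comment> \<open>Above the diameter the covering hypothesis says nothing, but there a single
      point covers \<open>S\<close>; hence the \<open>max 1 c\<close>.\<close>
    then have le: "dT x y \<le> ?\<epsilon>" if "x \<in> S" "y \<in> S" for x y
      using that unfolding ediam_def not_le by (meson SUP_upper2 order.strict_implies_order order.trans order_refl)
    have one: "1 \<le> max 1 c * (2 powr e) ^ k" using pos by (metis max.cobounded1 mult_mono' mult_1 zero_le_one)
    show ?thesis
    proof (cases "S = {}")
      case True
      then show ?thesis using one by (intro exI[of _ "{}"]) (auto simp: is_cover_def)
    next
      case False
      then obtain s where "s \<in> S" by blast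
      then show ?thesis using le one by (intro exI[of _ "{s}"]) (auto simp: is_cover_def)
    qed
  qed
qed

text \<open>The union of all coarser covers is nested in \<open>k\<close>, which lets chaining
  compare consecutive projections of a point inside one net. Since the bounds grow geometrically,
  the union costs only a constant factor.\<close>

lemma exists_nested_nets:
  assumes S: "Ext_pseudo_metric T dT" "S \<subseteq> T"
    and bcn: "bounded_covering_number dT S c e" and e: "0 < e"
  obtains V :: "nat \<Rightarrow> 'a set" and k0 :: nat
  where "\<And>k. finite (V k)" "\<And>k. is_cover dT (ennreal ((1/2) ^ k)) S (V k)"
    "\<And>k. V k \<subseteq> V (Suc k)" "\<And>k. real (card (V k)) \<le> (2 powr e) ^ (k + k0)"
proof -
  obtain C where C: "\<And>k. finite (C k)" "\<And>k. is_cover dT (ennreal ((1/2) ^ k)) S (C k)"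
      "\<And>k. real (card (C k)) \<le> max 1 c * (2 powr e) ^ k"
    using exists_dyadic_cover[OF assms] by metis
  define a where "a = 2 powr e"
  have a: "1 < a" using e by (simp add: a_def)
  \<comment> \<open>The factor \<open>a / (a - 1)\<close> comes from the geometric sum. All
    constants become a shift of the exponent, because \<open>pair_reduction\<close> takes a pure
    power of \<open>a\<close> as cardinality bound.\<close>
  obtain k0 where k0: "max 1 c * a / (a - 1) < a ^ k0"
    using real_arch_pow[OF a] by blast
  have "real (card (\<Union>j\<le>k. C j)) \<le> a ^ (k + k0)" for k
  proof -
    have "real (card (\<Union>j\<le>k. C j)) \<le> real (\<Sum>j\<le>k. card (C j))"
      by (intro of_nat_mono card_UN_le) simp
    also have "\<dots> \<le> (\<Sum>j\<le>k. max 1 c * a ^ j)"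
      using C(3) by (auto intro: sum_mono simp: a_def)
    also have "\<dots> = max 1 c * ((a ^ Suc k - 1) / (a - 1))"
      unfolding sum_distrib_left[symmetric] lessThan_Suc_atMost[symmetric]
      using a by (subst geometric_sum) simp_all
    also have "\<dots> \<le> max 1 c * (a ^ Suc k / (a - 1))"
      using a by (intro mult_left_mono divide_right_mono) auto
    also have "\<dots> = a ^ k * (max 1 c * a / (a - 1))" by (simp add: ac_simps)
    also have "\<dots> \<le> a ^ k * a ^ k0" using k0 a by (intro mult_left_mono) auto
    finally show ?thesis by (simp add: power_add)
  qed
  then show thesis
    using C(1,2) by (intro that[of "\<lambda>k. \<Union>j\<le>k. C j" k0])
      (auto simp: a_def is_cover_def le_SucI, fastforce+)
qed

section \<open>Moment estimates\<close>

lemma epowr_mono: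
  assumes "0 \<le> r" "x \<le> y"
  shows "x epowr r \<le> y epowr r"
proof (cases y)
  case (real b)
  then obtain a where "x = ennreal a" "0 \<le> a" using assms by (cases x) (auto simp: top_unique)
  then show ?thesis
    using real assms by (auto simp: epowr_def intro!: ennreal_leI powr_mono2)
qed (simp add: epowr_def)

lemma ennreal_epowr: "0 \<le> x \<Longrightarrow> 0 < r \<Longrightarrow> ennreal x epowr r = ennreal (x powr r)"
  by (simp add: epowr_def)

lemma borel_measurable_epowr [measurable (raw)]:
  "f \<in> borel_measurable M \<Longrightarrow> (\<lambda>x. f x epowr r) \<in> borel_measurable M"
  by (cases "r = 0") (simp_all add: epowr_def)

lemma power_powr_swap: "0 < w \<Longrightarrow> (w ^ k) powr x = (w powr x) ^ k" for w :: real
  by (induction k) (simp_all add: powr_mult)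

lemma powr_divide_power:
  fixes z w :: real
  assumes "0 \<le> z" "0 < w"
  shows "(z / w ^ k) powr x = z powr x * (w powr - x) ^ k"
proof -
  have "(z / w ^ k) powr x = z powr x / (w ^ k) powr x"
    by (rule powr_divide)
  also have "\<dots> = z powr x * (w powr - x) ^ k"
    by (simp only: power_powr_swap[OF assms(2)] powr_minus power_inverse divide_inverse)
  finally show ?thesis .
qed

lemma half_powr: "(1/2) powr x = 2 powr - x" for x :: real
  by (simp add: powr_divide powr_minus_divide)

lemma le_of_weighted_epowr_le:
  assumes "0 < p" "0 < w" "0 \<le> z" and le: "x epowr p * ennreal w \<le> ennreal z"
  shows "x \<le> ennreal ((z / w) powr (1 / p))"
proof (cases x)
  case (real y)
  then have "ennreal (y powr p * w) \<le> ennreal z"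
    using le assms by (simp add: ennreal_epowr ennreal_mult)
  then have "y powr p \<le> z / w" using assms by (simp add: field_simps)
  then have "(y powr p) powr (1 / p) \<le> (z / w) powr (1 / p)"
    using assms by (intro powr_mono2) auto
  then show ?thesis using real assms by (simp add: powr_powr ennreal_leI)
next
  case top
  then show ?thesis using le assms by (simp add: epowr_def ennreal_top_mult top_unique)
qed

text \<open>Instead of Markov and Borel-Cantelli: the series \<open>Z\<close> of all p-th powers
  with weights \<open>w ^ k\<close> has finite expectation, hence is almost surely finite. Each term
  is at most \<open>Z\<close>, so \<open>B\<close> is the p-th root of \<open>Z\<close>, one
  constant for all levels.\<close>

lemma AE_dist_le_geometric:
  fixes K :: "nat \<Rightarrow> ('t \<times> 't) set" and r :: "nat \<Rightarrow> real"
  assumes E: "Ext_pseudo_metric E dE"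
    and kol: "kolmogorov_condition P T dT E dE X p q M"
    and "0 < p" "0 < q" "0 \<le> M" "0 < w"
    and fin: "\<And>k. finite (K k)" and sub: "\<And>k. K k \<subseteq> T \<times> T"
    and r: "\<And>k. 0 \<le> r k" "\<And>k s t. (s, t) \<in> K k \<Longrightarrow> dT s t \<le> ennreal (r k)"
    and summable: "summable (\<lambda>k. real (card (K k)) * r k powr q * w ^ k)"
  shows "AE \<omega> in P. \<exists>B\<ge>0. \<forall>k. \<forall>(s, t)\<in>K k.
    dE (X s \<omega>) (X t \<omega>) \<le> ennreal (B * (w powr - (1 / p)) ^ k)"
proof -
  interpret E: Ext_pseudo_metric E dE by (rule E)
  have meas: "(\<lambda>\<omega>. dE (X s \<omega>) (X t \<omega>)) \<in> borel_measurable P" if "s \<in> T" "t \<in> T" for s t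
    using kol that by (intro E.measurable_dist) (auto simp: kolmogorov_condition_def)
  define g where "g k z \<omega> = dE (X (fst z) \<omega>) (X (snd z) \<omega>) epowr p * ennreal (w ^ k)" for k z \<omega>
  have g_meas: "g k z \<in> borel_measurable P" if "z \<in> K k" for k z
    unfolding g_def using sub[of k] that by (intro borel_measurable_times_ennreal borel_measurable_epowr meas) auto
  have int_g: "(\<integral>\<^sup>+\<omega>. g k z \<omega> \<partial>P) \<le> ennreal (M * r k powr q * w ^ k)" if z: "z \<in> K k" for k z
  proof -
    have zT: "fst z \<in> T" "snd z \<in> T" using sub[of k] z by auto
    have "(\<integral>\<^sup>+\<omega>. g k z \<omega> \<partial>P) =
        (\<integral>\<^sup>+\<omega>. dE (X (fst z) \<omega>) (X (snd z) \<omega>) epowr p \<partial>P) * ennreal (w ^ k)"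
      unfolding g_def using zT by (intro nn_integral_multc borel_measurable_epowr meas)
    also have "\<dots> \<le> ennreal M * (dT (fst z) (snd z) epowr q) * ennreal (w ^ k)"
      using kol zT by (intro mult_right_mono) (auto simp: kolmogorov_condition_def)
    also have "\<dots> \<le> ennreal M * (ennreal (r k) epowr q) * ennreal (w ^ k)"
      using r(2)[of "fst z" "snd z" k] z \<open>0 < q\<close> by (intro mult_right_mono mult_left_mono epowr_mono) auto
    also have "\<dots> = ennreal (M * r k powr q * w ^ k)"
      using r(1)[of k] \<open>0 < q\<close> \<open>0 \<le> M\<close> \<open>0 < w\<close> by (simp add: ennreal_epowr ennreal_mult)
    finally show ?thesis .
  qed
  define Z where "Z \<omega> = (\<Sum>k. \<Sum>z\<in>K k. g k z \<omega>)" for \<omega>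
  have "(\<integral>\<^sup>+\<omega>. Z \<omega> \<partial>P) = (\<Sum>k. \<Sum>z\<in>K k. \<integral>\<^sup>+\<omega>. g k z \<omega> \<partial>P)"
    unfolding Z_def using g_meas by (simp add: nn_integral_suminf nn_integral_sum)
  also have "\<dots> \<le> (\<Sum>k. \<Sum>z\<in>K k. ennreal (M * r k powr q * w ^ k))"
    by (intro suminf_le sum_mono int_g) simp_all
  also have "\<dots> = (\<Sum>k. ennreal (M * (real (card (K k)) * r k powr q * w ^ k)))"
  proof (intro suminf_cong)
    fix k
    have "(\<Sum>z\<in>K k. ennreal (M * r k powr q * w ^ k)) = ennreal (real (card (K k)) * (M * r k powr q * w ^ k))"
      by (simp only: sum_constant ennreal_of_nat_eq_real_of_nat ennreal_mult'[OF of_nat_0_le_iff])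
    then show "(\<Sum>z\<in>K k. ennreal (M * r k powr q * w ^ k)) = ennreal (M * (real (card (K k)) * r k powr q * w ^ k))"
      by (simp only: mult_ac)
  qed
  also have "\<dots> < \<infinity>"
    unfolding infinity_ennreal_def less_top[symmetric]
    by (rule ennreal_suminf_neq_top[OF summable_mult[OF summable]])
      (intro mult_nonneg_nonneg powr_ge_zero zero_le_power of_nat_0_le_iff \<open>0 \<le> M\<close> less_imp_le[OF \<open>0 < w\<close>])
  finally have "(\<integral>\<^sup>+\<omega>. Z \<omega> \<partial>P) \<noteq> \<infinity>" by (rule less_imp_neq)
  moreover have "Z \<in> borel_measurable P"
    unfolding Z_def using g_meas by (intro borel_measurable_suminf_order borel_measurable_sum) auto
  ultimately have "AE \<omega> in P. Z \<omega> \<noteq> \<infinity>" by (rule nn_integral_noteq_infinite[rotated])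
  then show ?thesis
  proof eventually_elim
    case (elim \<omega>)
    then obtain z where z: "0 \<le> z" "Z \<omega> = ennreal z" by (cases "Z \<omega>") simp_all
    have "dE (X s \<omega>) (X t \<omega>) \<le> ennreal (z powr (1 / p) * (w powr - (1 / p)) ^ k)"
      if st: "(s, t) \<in> K k" for s t k
    proof -
      have "g k (s, t) \<omega> \<le> (\<Sum>z\<in>K k. g k z \<omega>)"
        using st by (rule member_le_sum) (simp_all add: fin)
      also have "\<dots> \<le> Z \<omega>"
        unfolding Z_def using sum_le_suminf[of "\<lambda>k. \<Sum>z\<in>K k. g k z \<omega>" "{k}"] by simp
      finally have "dE (X s \<omega>) (X t \<omega>) epowr p * ennreal (w ^ k) \<le> ennreal z"
        by (simp add: g_def z)
      then have "dE (X s \<omega>) (X t \<omega>) \<le> ennreal ((z / w ^ k) powr (1 / p))"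
        using le_of_weighted_epowr_le[of p "w ^ k" z] \<open>0 < p\<close> \<open>0 < w\<close> z(1) by simp
      also have "(z / w ^ k) powr (1 / p) = z powr (1 / p) * (w powr - (1 / p)) ^ k"
        using \<open>0 < w\<close> z(1) by (simp only: powr_divide_power)
      finally show ?thesis .
    qed
    then show ?case by (intro exI[of _ "z powr (1 / p)"] conjI allI ballI) (simp_all add: split_beta)
  qed
qed

section \<open>Chaining\<close>

text \<open>
  A Hoelder condition of order \<open>\<gamma>\<close> at distances at most 1, for \<open>\<rho> = 2 powr - \<gamma>\<close>; the dyadic form
  avoids powers of extended reals and also covers pairs at distance 0.
\<close>

definition dyadic_holder ::
    "('t \<Rightarrow> 't \<Rightarrow> ennreal) \<Rightarrow> ('e \<Rightarrow> 'e \<Rightarrow> ennreal) \<Rightarrow> real \<Rightarrow> 't set \<Rightarrow> ('t \<Rightarrow> 'e) \<Rightarrow> bool"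
  where "dyadic_holder dT dE \<rho> A f \<longleftrightarrow>
    (\<exists>C\<ge>0. \<forall>m. \<forall>s\<in>A. \<forall>t\<in>A. dT s t \<le> ennreal ((1/2) ^ m) \<longrightarrow> dE (f s) (f t) \<le> ennreal (C * \<rho> ^ m))"

text \<open>Two points at distance at most 2^-m are joined through their projections at level m, and
  each point to its projection along finer levels. The constant 3 fits both kinds of link: 2^-k +
  2^-(k+1) = 3 * 2^-(k+1) for consecutive projections, and three times 2^-m for the projections of
  the two points.\<close>

lemma dyadic_holder_chaining:
  fixes V :: "nat \<Rightarrow> 't set" and \<pi> :: "nat \<Rightarrow> 't \<Rightarrow> 't"
  assumes T: "Ext_pseudo_metric T dT" and E: "Ext_pseudo_metric E dE"
    and f: "f \<in> T \<rightarrow> E" and V: "\<And>k. V k \<subseteq> T" "\<And>k. V k \<subseteq> V (Suc k)"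
    and D: "D \<subseteq> T" and \<rho>: "0 < \<rho>" "\<rho> < 1" and "0 \<le> B"
    and net: "\<And>k s t. s \<in> V k \<Longrightarrow> t \<in> V k \<Longrightarrow> dT s t \<le> ennreal (3 * (1/2) ^ k) \<Longrightarrow>
      dE (f s) (f t) \<le> ennreal (B * \<rho> ^ k)"
    and \<pi>: "\<And>k s. s \<in> D \<Longrightarrow> \<pi> k s \<in> V k" "\<And>k s. s \<in> D \<Longrightarrow> dT (\<pi> k s) s \<le> ennreal ((1/2) ^ k)"
    and lim: "\<And>s. s \<in> D \<Longrightarrow> (\<lambda>k. dE (f (\<pi> k s)) (f s)) \<longlonglongrightarrow> 0"
  shows "dyadic_holder dT dE \<rho> D f"
proof -
  interpret T: Ext_pseudo_metric T dT by (rule T)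
  interpret E: Ext_pseudo_metric E dE by (rule E)
  have \<pi>T: "\<pi> k s \<in> T" if "s \<in> D" for k s using \<pi>(1)[OF that] V(1) by blast
  have fE: "f s \<in> E" if "s \<in> T" for s using f that by blast
  \<comment> \<open>The sum of \<open>B * \<rho> ^ j\<close> over positive \<open>j\<close>; the
    links beyond level \<open>m\<close> add up to at most \<open>L * \<rho> ^ m\<close>.\<close>
  define L where "L = B * \<rho> / (1 - \<rho>)"
  have L: "0 \<le> L" "L * (1 - \<rho>) = B * \<rho>" using \<rho> \<open>0 \<le> B\<close> by (auto simp: L_def)
  have near: "dT (\<pi> k s) (\<pi> l t) \<le> ennreal ((1/2) ^ k) + dT s t + ennreal ((1/2) ^ l)"
    if "s \<in> D" "t \<in> D" for k l s t
  proof -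
    have S: "s \<in> T" "t \<in> T" using that D by auto
    have "dT (\<pi> k s) (\<pi> l t) \<le> dT (\<pi> k s) t + dT t (\<pi> l t)"
      using that S \<pi>T by (intro T.triangle) auto
    also have "dT (\<pi> k s) t \<le> dT (\<pi> k s) s + dT s t"
      using that S \<pi>T by (intro T.triangle) auto
    also have "dT t (\<pi> l t) = dT (\<pi> l t) t" using that S \<pi>T by (intro T.commute) auto
    finally show ?thesis
      using \<pi>(2)[OF that(1), of k] \<pi>(2)[OF that(2), of l]
      by (meson add_mono order.trans order_refl add_right_mono)
  qed
  have step: "dE (f (\<pi> k s)) (f (\<pi> (Suc k) s)) \<le> ennreal (B * \<rho> ^ Suc k)" if s: "s \<in> D" for k s
  proof (rule net)
    show "\<pi> k s \<in> V (Suc k)" "\<pi> (Suc k) s \<in> V (Suc k)" using \<pi>(1)[OF s] V(2) by blast+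
    have "dT (\<pi> k s) (\<pi> (Suc k) s) \<le> ennreal ((1/2) ^ k) + ennreal ((1/2) ^ Suc k)"
      using near[OF s s, of k "Suc k"] T.refl[of s] s D by (auto simp: subset_iff)
    also have "\<dots> = ennreal (3 * (1/2) ^ Suc k)"
      by (subst ennreal_plus[symmetric]) auto
    finally show "dT (\<pi> k s) (\<pi> (Suc k) s) \<le> ennreal (3 * (1/2) ^ Suc k)" .
  qed
  have telescope: "dE (f (\<pi> m s)) (f (\<pi> (m + i) s)) \<le> ennreal (L * (\<rho> ^ m - \<rho> ^ (m + i)))"
    if s: "s \<in> D" for m i s
  proof (induction i)
    case 0
    then show ?case using E.refl fE \<pi>T s by simp
  next
    case (Suc i)
    have "dE (f (\<pi> m s)) (f (\<pi> (m + Suc i) s)) \<le>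
        dE (f (\<pi> m s)) (f (\<pi> (m + i) s)) + dE (f (\<pi> (m + i) s)) (f (\<pi> (m + Suc i) s))"
      using fE \<pi>T s by (intro E.triangle) auto
    also have "\<dots> \<le> ennreal (L * (\<rho> ^ m - \<rho> ^ (m + i))) + ennreal (B * \<rho> ^ Suc (m + i))"
      using Suc step[OF s, of "m + i"] by (intro add_mono) auto
    also have "\<dots> = ennreal (L * (\<rho> ^ m - \<rho> ^ (m + i)) + B * \<rho> ^ Suc (m + i))"
      using L \<rho> \<open>0 \<le> B\<close> by (intro ennreal_plus[symmetric] mult_nonneg_nonneg) (auto intro: power_decreasing)
    also have "B * \<rho> ^ Suc (m + i) = L * (1 - \<rho>) * \<rho> ^ (m + i)" by (simp add: L)
    finally show ?case by (simp add: algebra_simps)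
  qed
  have chain: "dE (f (\<pi> m s)) (f (\<pi> k s)) \<le> ennreal (L * \<rho> ^ m)" if "s \<in> D" "m \<le> k" for m k s
  proof -
    have "dE (f (\<pi> m s)) (f (\<pi> k s)) \<le> ennreal (L * (\<rho> ^ m - \<rho> ^ k))"
      using telescope[OF that(1), of m "k - m"] that(2) by simp
    also have "\<dots> \<le> ennreal (L * \<rho> ^ m)"
      using L \<rho> by (intro ennreal_leI mult_left_mono) auto
    finally show ?thesis .
  qed
  have "dE (f s) (f t) \<le> ennreal ((2 * L + B) * \<rho> ^ m)"
    if st: "s \<in> D" "t \<in> D" "dT s t \<le> ennreal ((1/2) ^ m)" for s t m
  proof (rule E.dist_le_of_tendsto[OF _ _ _ _ lim lim])
    show "\<forall>\<^sub>F k in sequentially. dE (f (\<pi> k s)) (f (\<pi> k t)) \<le> ennreal ((2 * L + B) * \<rho> ^ m)"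
      using eventually_ge_at_top[of m]
    proof eventually_elim
      case (elim k)
      have "dT (\<pi> m s) (\<pi> m t) \<le> ennreal ((1/2) ^ m) + ennreal ((1/2) ^ m) + ennreal ((1/2) ^ m)"
        using near[OF st(1,2), of m m] st(3) by (meson add_left_mono add_right_mono order.trans)
      also have "\<dots> = ennreal (3 * (1/2) ^ m)"
        by (simp add: ennreal_plus[symmetric] del: ennreal_plus)
      finally have "dE (f (\<pi> m s)) (f (\<pi> m t)) \<le> ennreal (B * \<rho> ^ m)"
        using net \<pi>(1) st by blast
      moreover have "dE (f (\<pi> k s)) (f (\<pi> k t)) \<le>
          dE (f (\<pi> k s)) (f (\<pi> m s)) + dE (f (\<pi> m s)) (f (\<pi> k t))"
        using fE \<pi>T st by (intro E.triangle) auto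
      moreover have "dE (f (\<pi> m s)) (f (\<pi> k t)) \<le>
          dE (f (\<pi> m s)) (f (\<pi> m t)) + dE (f (\<pi> m t)) (f (\<pi> k t))"
        using fE \<pi>T st by (intro E.triangle) auto
      moreover have "dE (f (\<pi> k s)) (f (\<pi> m s)) \<le> ennreal (L * \<rho> ^ m)"
        using chain[OF st(1) elim] E.commute fE \<pi>T st by simp
      moreover note chain[OF st(2) elim]
      ultimately have "dE (f (\<pi> k s)) (f (\<pi> k t)) \<le>
          ennreal (L * \<rho> ^ m) + (ennreal (B * \<rho> ^ m) + ennreal (L * \<rho> ^ m))"
        by (meson add_mono order.trans)
      also have "\<dots> = ennreal (L * \<rho> ^ m + (B * \<rho> ^ m + L * \<rho> ^ m))"
        using L \<rho> \<open>0 \<le> B\<close> by (simp add: ennreal_plus[symmetric] del: ennreal_plus)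
      finally show ?case by (simp add: algebra_simps)
    qed
  qed (use st D fE \<pi>T in auto)
  moreover have "0 \<le> 2 * L + B" using L \<open>0 \<le> B\<close> by simp
  ultimately show ?thesis unfolding dyadic_holder_def by blast
qed

section \<open>Almost sure estimates for the process along approximating sequences and nets\<close>

lemma AE_tendsto_of_geometric_approx:
  assumes E: "Ext_pseudo_metric E dE"
    and kol: "kolmogorov_condition P T dT E dE X p q M"
    and pos: "0 < p" "0 < q" "0 \<le> M"
    and u: "\<And>k. u k \<in> T" "t \<in> T" "\<And>k. dT (u k) t \<le> ennreal ((1/2) ^ k)"
  shows "AE \<omega> in P. (\<lambda>k. dE (X (u k) \<omega>) (X t \<omega>)) \<longlonglongrightarrow> 0"
proof -
  \<comment> \<open>Half of the decay 2^(-q k) of the moments pays for summability, the other half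
    makes the increments tend to 0. The geometric rate gives convergence of the whole sequence, not
    just of a subsequence.\<close>
  define w where "w = 2 powr (q / 2)"
  have w: "0 < w" by (simp add: w_def)
  have "summable (\<lambda>k. (2 powr - (q / 2)) ^ k)"
    using pos by (intro summable_geometric) (simp add: powr_less_one)
  moreover have "real (card {(u k, t)}) * ((1/2) ^ k) powr q * w ^ k = (2 powr - (q / 2)) ^ k" for k
  proof -
    have "((1/2) ^ k) powr q * w ^ k = ((1/2) powr q * w) ^ k"
      using power_powr_swap[of "1/2" k q] by (simp only: power_mult_distrib)
    also have "(1/2) powr q * w = 2 powr - (q / 2)"
      by (simp only: half_powr w_def powr_add[symmetric]) simp
    finally show ?thesis by simp
  qed
  ultimately have "AE \<omega> in P. \<exists>B\<ge>0. \<forall>k. \<forall>(s, t)\<in>{(u k, t)}.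
      dE (X s \<omega>) (X t \<omega>) \<le> ennreal (B * (w powr - (1 / p)) ^ k)"
    by (intro AE_dist_le_geometric[OF E kol pos w, where r = "\<lambda>k. (1/2) ^ k"]) (simp_all add: u)
  then show ?thesis
  proof eventually_elim
    case (elim \<omega>)
    then obtain B where B: "B \<ge> 0" "\<And>k. dE (X (u k) \<omega>) (X t \<omega>) \<le> ennreal (B * (w powr - (1 / p)) ^ k)"
      by auto
    have "w powr - (1 / p) < 1"
      using pos by (simp add: w_def powr_powr powr_less_one)
    then have "(\<lambda>k. B * (w powr - (1 / p)) ^ k) \<longlonglongrightarrow> 0"
      by (intro tendsto_mult_right_zero LIMSEQ_realpow_zero) auto
    then have "(\<lambda>k. ennreal (B * (w powr - (1 / p)) ^ k)) \<longlonglongrightarrow> 0"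
      using B(1) by (subst ennreal_tendsto_0_iff) auto
    then show ?case
      by (rule tendsto_sandwich[OF _ _ tendsto_const, rotated 2]) (use B in auto)
  qed
qed

lemma AE_holder_on_nets:
  assumes T: "Ext_pseudo_metric T dT" and E: "Ext_pseudo_metric E dE"
    and kol: "kolmogorov_condition P T dT E dE X p q M"
    and pos: "0 < p" "0 < q" "0 \<le> M" "0 \<le> e" and \<gamma>: "\<gamma> < (q - e) / p"
    and V: "\<And>k. finite (V k)" "\<And>k. V k \<subseteq> T" "\<And>k. real (card (V k)) \<le> (2 powr e) ^ (k + k0)"
  shows "AE \<omega> in P. \<exists>B\<ge>0. \<forall>k. \<forall>s\<in>V k. \<forall>t\<in>V k. dT s t \<le> ennreal (3 * (1/2) ^ k) \<longrightarrow>
    dE (X s \<omega>) (X t \<omega>) \<le> ennreal (B * (2 powr - \<gamma>) ^ k)"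
proof -
  interpret E: Ext_pseudo_metric E dE by (rule E)
  define a where "a = 2 powr e"
  have a: "1 \<le> a" using pos by (simp add: a_def ge_one_powr_ge_zero)
  define good where "good k K \<longleftrightarrow> K \<subseteq> V k \<times> V k \<and> real (card K) \<le> a * real (card (V k)) \<and>
      (\<forall>s t. (s, t) \<in> K \<longrightarrow> dT s t \<le> of_nat (k + k0) * ennreal (3 * (1/2) ^ k)) \<and>
      (\<forall>s\<in>V k. \<forall>t\<in>V k. dT s t \<le> ennreal (3 * (1/2) ^ k) \<longrightarrow>
        (\<exists>u\<in>V k. (u, s) \<in> K \<and> (u, t) \<in> K))" for k K
  have "\<exists>K. good k K" for k
    using pair_reduction[OF T a V(1) V(2) V(3)[folded a_def], where b = "ennreal (3 * (1/2) ^ k)"]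
    unfolding good_def .
  then obtain K where "\<And>k. good k (K k)" by metis
  then have K: "\<And>k. K k \<subseteq> V k \<times> V k"
    "\<And>k. real (card (K k)) \<le> a * real (card (V k))"
    "\<And>k s t. (s, t) \<in> K k \<Longrightarrow> dT s t \<le> of_nat (k + k0) * ennreal (3 * (1/2) ^ k)"
    "\<And>k s t. s \<in> V k \<Longrightarrow> t \<in> V k \<Longrightarrow> dT s t \<le> ennreal (3 * (1/2) ^ k) \<Longrightarrow>
        \<exists>u\<in>V k. (u, s) \<in> K k \<and> (u, t) \<in> K k"
    unfolding good_def by blast+
  define r where "r k = real (k + k0) * (3 * (1/2) ^ k)" for k
  \<comment> \<open>Chosen so that \<open>w powr - (1 / p)\<close> is
    \<open>2 powr - \<gamma>\<close>.\<close>
  define w where "w = 2 powr (\<gamma> * p)"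
  have w: "0 < w" by (simp add: w_def)
  \<comment> \<open>The geometric ratio of the weighted moments: \<open>e\<close> from the number of
    pairs, \<open>\<gamma> * p\<close> from the weight, \<open>- q\<close> from the moment
    bound.\<close>
  define \<theta> where "\<theta> = 2 powr (e + \<gamma> * p - q)"
  have "\<gamma> * p < q - e" using \<gamma> pos by (simp add: field_simps)
  then have \<theta>: "0 < \<theta>" "\<theta> < 1" by (auto simp: \<theta>_def powr_less_one)
  have eq: "a * a ^ (k + k0) * r k powr q * w ^ k =
      (a ^ Suc k0 * 3 powr q) * ((real k + real k0) powr q * \<theta> ^ k)" for k
  proof -
    have "a ^ k * ((1/2) ^ k) powr q * w ^ k = (a * (1/2) powr q * w) ^ k"
      using power_powr_swap[of "1/2" k q] by (simp only: power_mult_distrib)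
    also have "a * (1/2) powr q * w = \<theta>"
      by (simp only: a_def half_powr w_def \<theta>_def powr_add[symmetric]) (simp add: algebra_simps)
    finally have "a ^ k * ((1/2) ^ k) powr q * w ^ k = \<theta> ^ k" .
    then have "(a ^ Suc k0 * 3 powr q) * ((real k + real k0) powr q * \<theta> ^ k) =
        (a ^ Suc k0 * 3 powr q) * ((real k + real k0) powr q * (a ^ k * ((1/2) ^ k) powr q * w ^ k))"
      by (simp only:)
    also have "\<dots> = a * a ^ (k + k0) * ((real k + real k0) powr q * (3 powr q * ((1/2) ^ k) powr q)) * w ^ k"
      by (simp only: power_add power_Suc mult_ac)
    also have "(real k + real k0) powr q * (3 powr q * ((1/2) ^ k) powr q) = r k powr q"
      by (simp add: r_def powr_mult)
    finally show ?thesis by (rule sym)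
  qed
  have "AE \<omega> in P. \<exists>B\<ge>0. \<forall>k. \<forall>(s, t)\<in>K k.
      dE (X s \<omega>) (X t \<omega>) \<le> ennreal (B * (w powr - (1 / p)) ^ k)"
  proof (rule AE_dist_le_geometric[OF E kol pos(1-3) w])
    show "finite (K k)" for k using K(1) V(1) by (meson finite_SigmaI finite_subset)
    show "K k \<subseteq> T \<times> T" for k using K(1)[of k] V(2)[of k] by auto
    show "0 \<le> r k" for k by (simp add: r_def)
    show "dT s t \<le> ennreal (r k)" if "(s, t) \<in> K k" for k s t
      using K(3)[OF that] by (simp add: r_def ennreal_mult ennreal_of_nat_eq_real_of_nat del: of_nat_add)
    show "summable (\<lambda>k. real (card (K k)) * r k powr q * w ^ k)"
    proof (rule summable_comparison_test')
      show "summable (\<lambda>k. a * a ^ (k + k0) * r k powr q * w ^ k)"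
        unfolding eq by (intro summable_mult summable_poly_geometric \<theta>)
      show "norm (real (card (K k)) * r k powr q * w ^ k) \<le> a * a ^ (k + k0) * r k powr q * w ^ k" for k
      proof -
        have "real (card (K k)) \<le> a * a ^ (k + k0)"
          using K(2)[of k] V(3)[of k] a by (smt (verit) a_def mult_left_mono)
        then show ?thesis using w by (simp add: abs_mult mult_right_mono)
      qed
    qed
  qed
  then show ?thesis
    using AE_space
  proof eventually_elim
    case (elim \<omega>)
    \<comment> \<open>The Kolmogorov condition is the only hypothesis on \<open>X\<close> here; its
      measurability part for the pair of \<open>s\<close> with itself puts the values in
      \<open>E\<close>.\<close>
    have XE: "X s \<omega> \<in> E" if "s \<in> T" for s
    proof -
      have "(\<lambda>\<omega>. (X s \<omega>, X s \<omega>)) \<in> measurable P (borel_of (prod_topology E.mtopology E.mtopology))"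
        using kol that by (auto simp: kolmogorov_condition_def)
      from measurable_space[OF this elim(2)] show ?thesis by simp
    qed
    have wp: "w powr - (1 / p) = 2 powr - \<gamma>" using pos by (simp add: w_def powr_powr)
    obtain B where B: "B \<ge> 0"
        "\<And>k s t. (s, t) \<in> K k \<Longrightarrow> dE (X s \<omega>) (X t \<omega>) \<le> ennreal (B * (2 powr - \<gamma>) ^ k)"
      using elim(1) unfolding wp by blast
    have "dE (X s \<omega>) (X t \<omega>) \<le> ennreal (2 * B * (2 powr - \<gamma>) ^ k)"
      if st: "s \<in> V k" "t \<in> V k" "dT s t \<le> ennreal (3 * (1/2) ^ k)" for k s t
    proof -
      obtain u where u: "u \<in> V k" "(u, s) \<in> K k" "(u, t) \<in> K k" using K(4)[OF st] by blast
      have E': "X s \<omega> \<in> E" "X t \<omega> \<in> E" "X u \<omega> \<in> E" using st u V(2)[of k] XE by auto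
      have "dE (X s \<omega>) (X t \<omega>) \<le> dE (X u \<omega>) (X s \<omega>) + dE (X u \<omega>) (X t \<omega>)"
        using E.triangle[of "X s \<omega>" "X u \<omega>" "X t \<omega>"] E' by (simp add: E.commute)
      also have "\<dots> \<le> ennreal (B * (2 powr - \<gamma>) ^ k) + ennreal (B * (2 powr - \<gamma>) ^ k)"
        using B u by (intro add_mono) auto
      also have "\<dots> = ennreal (2 * B * (2 powr - \<gamma>) ^ k)"
        using B(1) by (simp add: ennreal_plus[symmetric] del: ennreal_plus)
      finally show ?thesis .
    qed
    then show ?case using B(1) by (intro exI[of _ "2 * B"]) auto
  qed
qed

lemma process_value_in_space:
  assumes "stochastic_process P T (borel_of \<T>) X" "t \<in> T" "\<omega> \<in> space P"
  shows "X t \<omega> \<in> topspace \<T>"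
  using assms measurable_space[of "X t" P "borel_of \<T>"] by (auto simp: stochastic_process_def)

text \<open>The nets belong to \<open>S\<close> alone, whereas \<open>D\<close> will also contain
  net points of other sets. Almost sure convergence along the projections, at countably many points
  at once, links the two.\<close>

lemma AE_dyadic_holder_on_countable:
  assumes T: "Ext_pseudo_metric T dT" and E: "Ext_pseudo_metric E dE"
    and X: "stochastic_process P T (borel_of (Ext_pseudo_metric.mtopology E dE)) X"
    and kol: "kolmogorov_condition P T dT E dE X p q M"
    and pos: "0 < p" "0 < q" "0 \<le> M" "0 < e" and \<gamma>: "0 < \<gamma>" "\<gamma> < (q - e) / p"
    and S: "S \<subseteq> T" "bounded_covering_number dT S c e" and D: "countable D" "D \<subseteq> S"
  shows "AE \<omega> in P. dyadic_holder dT dE (2 powr - \<gamma>) D (\<lambda>t. X t \<omega>)"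
proof -
  interpret T: Ext_pseudo_metric T dT by (rule T)
  interpret E: Ext_pseudo_metric E dE by (rule E)
  obtain V k0 where V: "\<And>k. finite (V k)" "\<And>k. is_cover dT (ennreal ((1/2) ^ k)) S (V k)"
      "\<And>k. V k \<subseteq> V (Suc k)" "\<And>k. real (card (V k)) \<le> (2 powr e) ^ (k + k0)"
    using exists_nested_nets[OF T S pos(4)] by metis
  have VT: "V k \<subseteq> T" for k using V(2)[of k] S by (auto simp: is_cover_def)
  have "\<exists>v\<in>V k. dT v s \<le> ennreal ((1/2) ^ k)" if "s \<in> S" for k s
    using V(2)[of k] that by (auto simp: is_cover_def)
  then have "\<forall>k s. \<exists>v. s \<in> S \<longrightarrow> v \<in> V k \<and> dT v s \<le> ennreal ((1/2) ^ k)" by blast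
  then obtain \<pi> where \<pi>: "\<And>k s. s \<in> S \<Longrightarrow> \<pi> k s \<in> V k" "\<And>k s. s \<in> S \<Longrightarrow> dT (\<pi> k s) s \<le> ennreal ((1/2) ^ k)"
    by metis
  have "AE \<omega> in P. (\<lambda>k. dE (X (\<pi> k s) \<omega>) (X s \<omega>)) \<longlonglongrightarrow> 0" if "s \<in> D" for s
  proof (rule AE_tendsto_of_geometric_approx[OF E kol pos(1-3)])
    have s: "s \<in> S" using that D by blast
    then show "s \<in> T" using S by blast
    show "\<pi> k s \<in> T" for k using \<pi>(1)[OF s, of k] VT[of k] by blast
    show "dT (\<pi> k s) s \<le> ennreal ((1/2) ^ k)" for k by (rule \<pi>(2)[OF s])
  qed
  then have "AE \<omega> in P. \<forall>s\<in>D. (\<lambda>k. dE (X (\<pi> k s) \<omega>) (X s \<omega>)) \<longlonglongrightarrow> 0"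
    using D by (simp add: AE_ball_countable)
  moreover have "AE \<omega> in P. \<exists>B\<ge>0. \<forall>k. \<forall>s\<in>V k. \<forall>t\<in>V k. dT s t \<le> ennreal (3 * (1/2) ^ k) \<longrightarrow>
      dE (X s \<omega>) (X t \<omega>) \<le> ennreal (B * (2 powr - \<gamma>) ^ k)"
    using AE_holder_on_nets[OF T E kol pos(1-3) less_imp_le[OF pos(4)] \<gamma>(2) V(1) VT V(4)] .
  ultimately show ?thesis
    using AE_space
  proof eventually_elim
    case (elim \<omega>)
    then obtain B where B: "B \<ge> 0" "\<And>k s t. s \<in> V k \<Longrightarrow> t \<in> V k \<Longrightarrow> dT s t \<le> ennreal (3 * (1/2) ^ k) \<Longrightarrow>
        dE (X s \<omega>) (X t \<omega>) \<le> ennreal (B * (2 powr - \<gamma>) ^ k)" by blast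
    show ?case
    proof (rule dyadic_holder_chaining[where f = "\<lambda>t. X t \<omega>" and V = V and \<pi> = \<pi>, OF T E _ VT V(3) _ _ _ B])
      show "(\<lambda>t. X t \<omega>) \<in> T \<rightarrow> E"
        using process_value_in_space[OF X _ elim(3)] by auto
      show "D \<subseteq> T" using D S by blast
      show "2 powr - \<gamma> < 1" using \<gamma> by (simp add: powr_less_one)
      show "\<pi> k s \<in> V k" "dT (\<pi> k s) s \<le> ennreal ((1/2) ^ k)" if "s \<in> D" for k s
        using \<pi> that D by blast+
      show "(\<lambda>k. dE (X (\<pi> k s) \<omega>) (X s \<omega>)) \<longlonglongrightarrow> 0" if "s \<in> D" for s
        using elim(1) that by blast
    qed simp
  qed
qed

section \<open>Extension from a countable dense set\<close>

lemma dyadic_holder_mono: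
  assumes "dyadic_holder dT dE \<rho> A f" "0 \<le> \<rho>" "\<rho> \<le> \<sigma>"
  shows "dyadic_holder dT dE \<sigma> A f"
proof -
  obtain C where C: "C \<ge> 0" "\<And>m s t. s \<in> A \<Longrightarrow> t \<in> A \<Longrightarrow> dT s t \<le> ennreal ((1/2) ^ m) \<Longrightarrow>
      dE (f s) (f t) \<le> ennreal (C * \<rho> ^ m)"
    using assms(1) unfolding dyadic_holder_def by blast
  have "ennreal (C * \<rho> ^ m) \<le> ennreal (C * \<sigma> ^ m)" for m
    using C(1) assms by (intro ennreal_leI mult_left_mono power_mono)
  then show ?thesis
    unfolding dyadic_holder_def using C by (meson order.trans)
qed

text \<open>This is where completeness of \<open>E\<close> enters: a Hoelder bound of any positive
  order makes the values along \<open>u\<close> Cauchy.\<close>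

lemma dyadic_holder_limit_exists:
  assumes T: "Ext_pseudo_metric T dT" and E: "Ext_pseudo_metric E dE"
    and complete: "Ext_pseudo_metric.mcomplete E dE"
    and f: "f \<in> T \<rightarrow> E" and D: "D \<subseteq> T" and \<rho>: "0 \<le> \<rho>" "\<rho> < 1"
    and holder: "dyadic_holder dT dE \<rho> D f"
    and u: "\<And>k. u k \<in> D" "t \<in> T" "\<And>k. dT (u k) t \<le> ennreal ((1/2) ^ k)"
  obtains x where "x \<in> E" "(\<lambda>k. dE (f (u k)) x) \<longlonglongrightarrow> 0"
proof -
  interpret T: Ext_pseudo_metric T dT by (rule T)
  interpret E: Ext_pseudo_metric E dE by (rule E)
  have uT: "u k \<in> T" for k using u D by blast
  have fE: "range (\<lambda>k. f (u k)) \<subseteq> E" using f uT by blast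
  obtain C where C: "C \<ge> 0" "\<And>m s t. s \<in> D \<Longrightarrow> t \<in> D \<Longrightarrow> dT s t \<le> ennreal ((1/2) ^ m) \<Longrightarrow>
      dE (f s) (f t) \<le> ennreal (C * \<rho> ^ m)"
    using holder unfolding dyadic_holder_def by blast
  have "E.MCauchy (\<lambda>k. f (u k))"
    unfolding E.MCauchy_def
  proof (intro conjI allI impI fE)
    fix \<epsilon> :: ennreal assume \<epsilon>: "0 < \<epsilon>"
    have "(\<lambda>m. C * \<rho> ^ m) \<longlonglongrightarrow> 0"
      using \<rho> by (intro tendsto_mult_right_zero LIMSEQ_realpow_zero)
    then have "(\<lambda>m. ennreal (C * \<rho> ^ m)) \<longlonglongrightarrow> 0"
      using C(1) \<rho> by (subst ennreal_tendsto_0_iff) auto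
    then obtain m where m: "ennreal (C * \<rho> ^ m) < \<epsilon>"
      using order_tendstoD(2)[OF _ \<epsilon>] by (force simp: eventually_sequentially)
    have "dE (f (u k)) (f (u l)) < \<epsilon>" if "k \<ge> Suc m" "l \<ge> Suc m" for k l
    proof -
      have half: "dT (u j) t \<le> ennreal ((1/2) ^ Suc m)" if "j \<ge> Suc m" for j
        using u(3)[of j] that by (rule order_trans[OF _ ennreal_leI[OF power_decreasing]]) auto
      have "dT (u k) (u l) \<le> dT (u k) t + dT (u l) t"
        using T.triangle[of "u k" t "u l"] uT u(2) by (simp add: T.commute)
      also have "\<dots> \<le> ennreal ((1/2) ^ Suc m) + ennreal ((1/2) ^ Suc m)"
        using half that by (intro add_mono)
      also have "\<dots> = ennreal ((1/2) ^ m)" by (simp add: ennreal_plus[symmetric] del: ennreal_plus)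
      finally show ?thesis using C(2) u(1) m by (meson le_less_trans)
    qed
    then show "\<exists>N. \<forall>n\<ge>N. \<forall>n'\<ge>N. dE (f (u n)) (f (u n')) < \<epsilon>" by blast
  qed
  then obtain x where x: "limitin E.mtopology (\<lambda>k. f (u k)) x sequentially"
    using complete unfolding E.mcomplete_def by blast
  moreover from this have "x \<in> E" by (simp add: limitin_def)
  ultimately show thesis using that E.limitin_imp_tendsto[OF fE] by blast
qed

text \<open>Passing to limits loses one dyadic level, and rounding a distance to a power of 1/2
  loses another; together they give the factor \<open>4 powr \<gamma>\<close>.\<close>

lemma holder_of_dyadic_approximation:
  assumes T: "Ext_pseudo_metric T dT" and E: "Ext_pseudo_metric E dE"
    and f: "f \<in> T \<rightarrow> E" and D: "D \<subseteq> T" and A: "A \<subseteq> T" and g: "g \<in> A \<rightarrow> E" and "0 < \<gamma>"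
    and holder: "dyadic_holder dT dE (2 powr - \<gamma>) D f"
    and u: "\<And>t k. t \<in> A \<Longrightarrow> u t k \<in> D" "\<And>t k. t \<in> A \<Longrightarrow> dT (u t k) t \<le> ennreal ((1/2) ^ k)"
    and lim: "\<And>t. t \<in> A \<Longrightarrow> (\<lambda>k. dE (f (u t k)) (g t)) \<longlonglongrightarrow> 0"
  obtains C where "0 \<le> C" "\<And>s t. s \<in> A \<Longrightarrow> t \<in> A \<Longrightarrow> dT s t \<le> ennreal (1/2) \<Longrightarrow>
    dE (g s) (g t) \<le> ennreal C * (dT s t epowr \<gamma>)"
proof -
  interpret T: Ext_pseudo_metric T dT by (rule T)
  interpret E: Ext_pseudo_metric E dE by (rule E)
  define \<rho> where "\<rho> = 2 powr - \<gamma>"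
  have \<rho>: "0 < \<rho>" "\<rho> < 1" using \<open>0 < \<gamma>\<close> by (auto simp: \<rho>_def powr_less_one)
  obtain C where C: "C \<ge> 0" "\<And>m s t. s \<in> D \<Longrightarrow> t \<in> D \<Longrightarrow> dT s t \<le> ennreal ((1/2) ^ m) \<Longrightarrow>
      dE (f s) (f t) \<le> ennreal (C * \<rho> ^ m)"
    using holder unfolding dyadic_holder_def \<rho>_def by blast
  \<comment> \<open>The spare level leaves room for the approximating points: 2^-(m+2) + 2^-(m+1) +
    2^-(m+2) = 2^-m.\<close>
  have dyadic: "dE (g s) (g t) \<le> ennreal (C * \<rho> ^ m)"
    if st: "s \<in> A" "t \<in> A" "dT s t \<le> ennreal ((1/2) ^ Suc m)" for s t m
  proof (rule E.dist_le_of_tendsto[OF _ _ _ _ lim lim])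
    have S: "s \<in> T" "t \<in> T" "\<And>k. u s k \<in> T" "\<And>k. u t k \<in> T" using st A u D by blast+
    show "g s \<in> E" "g t \<in> E" using g st by auto
    show "range (\<lambda>k. f (u s k)) \<subseteq> E" "range (\<lambda>k. f (u t k)) \<subseteq> E" using f S by auto
    show "\<forall>\<^sub>F k in sequentially. dE (f (u s k)) (f (u t k)) \<le> ennreal (C * \<rho> ^ m)"
      using eventually_ge_at_top[of "m + 2"]
    proof eventually_elim
      case (elim k)
      have quarter: "dT (u r k) r \<le> ennreal ((1/2) ^ (m + 2))" if "r \<in> A" for r
        using u(2)[OF that, of k] elim
        by (rule order_trans[OF _ ennreal_leI[OF power_decreasing]]) auto
      have "dT (u s k) (u t k) \<le> dT (u s k) s + dT s (u t k)" using S by (intro T.triangle) auto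
      also have "dT s (u t k) \<le> dT s t + dT (u t k) t"
        using T.triangle[of s t "u t k"] S by (simp add: T.commute)
      finally have "dT (u s k) (u t k) \<le> dT (u s k) s + (dT s t + dT (u t k) t)"
        by (simp add: add_left_mono)
      also have "\<dots> \<le> ennreal ((1/2) ^ (m + 2)) + (ennreal ((1/2) ^ Suc m) + ennreal ((1/2) ^ (m + 2)))"
        using quarter st by (intro add_mono) auto
      also have "\<dots> = ennreal ((1/2) ^ m)"
        by (simp add: ennreal_plus[symmetric] del: ennreal_plus)
      finally show ?case using C(2) u(1) st by blast
    qed
  qed (use st in auto)
  have "dE (g s) (g t) \<le> ennreal (C * 4 powr \<gamma>) * (dT s t epowr \<gamma>)"
    if st: "s \<in> A" "t \<in> A" "dT s t \<le> ennreal (1/2)" for s t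
  proof -
    obtain x where x: "dT s t = ennreal x" "0 \<le> x"
      using st(3) by (cases "dT s t") (auto simp: top_unique)
    have x_half: "x \<le> 1/2" by (rule ennreal_le_iff[THEN iffD1]) (use st(3) x in simp_all)
    show ?thesis
    proof (cases "x = 0")
      \<comment> \<open>At distance 0 the dyadic bound holds for every \<open>m\<close>, which
        forces the images to distance 0.\<close>
      case True
      have "(\<lambda>m. C * \<rho> ^ m) \<longlonglongrightarrow> 0"
        using \<rho> by (intro tendsto_mult_right_zero LIMSEQ_realpow_zero) auto
      then have lim0: "(\<lambda>m. ennreal (C * \<rho> ^ m)) \<longlonglongrightarrow> 0"
        using C(1) \<rho> by (subst ennreal_tendsto_0_iff) auto
      have "dE (g s) (g t) \<le> ennreal (C * \<rho> ^ m)" for m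
        using dyadic[OF st(1,2)] x True by simp
      then have "dE (g s) (g t) \<le> 0"
        using tendsto_lowerbound[OF lim0] by (simp add: always_eventually)
      then show ?thesis by simp
    next
      case False
      \<comment> \<open>The level with 2^-(m+2) < x \<le> 2^-(m+1); for \<open>m = 0\<close> the
        upper bound is the assumed distance at most 1/2.\<close>
      define m where "m = (LEAST m. (1/2) ^ (m + 2) < x)"
      obtain n where "(1/2) ^ n < x" using real_arch_pow_inv[of x "1/2"] False x by auto
      then have "(1/2) ^ (n + 2) < x"
        by (rule le_less_trans[rotated]) (intro power_decreasing, auto)
      then have m: "(1/2) ^ (m + 2) < x" unfolding m_def by (rule LeastI)
      have "x \<le> (1/2) ^ Suc m"
      proof (cases m)
        case 0
        then show ?thesis using x_half by simp
      next
        case (Suc j)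
        then have "\<not> (1/2) ^ (j + 2) < x" unfolding m_def by (metis lessI not_less_Least)
        then show ?thesis using Suc by simp
      qed
      then have "dE (g s) (g t) \<le> ennreal (C * \<rho> ^ m)"
        using dyadic[OF st(1,2)] x by (simp add: ennreal_leI)
      also have "\<rho> ^ m = 4 powr \<gamma> * ((1/2) ^ (m + 2)) powr \<gamma>"
      proof -
        have "(1/2) powr \<gamma> = \<rho>" by (simp add: half_powr \<rho>_def)
        then have "((1/2) ^ (m + 2)) powr \<gamma> = \<rho> ^ (m + 2)"
          using power_powr_swap[of "1/2" "m + 2" \<gamma>] by simp
        also have "\<dots> = \<rho> ^ m * \<rho> ^ 2" by (simp only: power_add)
        also have "\<rho> ^ 2 = (1/4) powr \<gamma>"
          using power_powr_swap[of "1/2" 2 \<gamma>] \<open>(1/2) powr \<gamma> = \<rho>\<close> by (simp add: power2_eq_square)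
        finally have "4 powr \<gamma> * ((1/2) ^ (m + 2)) powr \<gamma> = \<rho> ^ m * (4 powr \<gamma> * (1/4) powr \<gamma>)"
          by (simp only: mult_ac)
        also have "4 powr \<gamma> * (1/4) powr \<gamma> = 1" by (simp add: powr_mult[symmetric])
        finally show ?thesis by simp
      qed
      also have "ennreal (C * (4 powr \<gamma> * ((1/2) ^ (m + 2)) powr \<gamma>)) \<le> ennreal (C * (4 powr \<gamma> * x powr \<gamma>))"
        using C(1) m \<open>0 < \<gamma>\<close> by (intro ennreal_leI mult_left_mono powr_mono2) auto
      also have "\<dots> = ennreal (C * 4 powr \<gamma>) * (dT s t epowr \<gamma>)"
        using C(1) x \<open>0 < \<gamma>\<close> by (simp add: ennreal_epowr ennreal_mult[symmetric] mult.assoc)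
      finally show ?thesis .
    qed
  qed
  then show thesis using that[of "C * 4 powr \<gamma>"] C(1) by simp
qed

theorem theorem4p21:
  fixes T :: "'t set" and dT :: "'t \<Rightarrow> 't \<Rightarrow> ennreal"
    and E :: "'e set" and dE :: "'e \<Rightarrow> 'e \<Rightarrow> ennreal"
    and P :: "'w measure" and X :: "'t \<Rightarrow> 'w \<Rightarrow> 'e"
    and Tn :: "nat \<Rightarrow> 't set" and c :: "nat \<Rightarrow> real" and d :: real
    and p q :: "nat \<Rightarrow> real"
  assumes "Ext_pseudo_metric T dT"
    and "Ext_pseudo_metric E dE"
    and "Ext_pseudo_metric.mcomplete E dE"
    and "prob_space P"
    and "incseq Tn"
    and "T \<subseteq> (\<Union>n. Tn n)"
    and "\<And>n. openin (Ext_pseudo_metric.mtopology T dT) (Tn n)"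
    and "\<And>n. Ext_pseudo_metric.mtotally_bounded T dT (Tn n)"
    and "d > 0"
    and "\<And>n. c n > 0"
    and "\<And>n. bounded_covering_number dT (Tn n) (c n) d"
    and "\<And>m. p m > 0"
    and "\<And>m. q m > 0"
    and "\<And>m. q m > d"
    and "stochastic_process P T (borel_of (Ext_pseudo_metric.mtopology E dE)) X"
    and "\<And>m. \<exists>M\<ge>0. kolmogorov_condition P T dT E dE X (p m) (q m) M"
  shows "\<exists>Y. modification P T (borel_of (Ext_pseudo_metric.mtopology E dE)) X Y \<and>
    (\<forall>\<omega>\<in>space P. \<forall>\<gamma>>0. ereal \<gamma> < (SUP m. ereal ((q m - d) / p m)) \<longrightarrow>
       locally_holder T dT dE \<gamma> (\<lambda>t. Y t \<omega>))"
proof -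
  note T = assms(1) and E = assms(2) and complete = assms(3) and inc = assms(5) and cover = assms(6)
    and openT = assms(7) and d = assms(9) and bcn = assms(11) and p = assms(12) and q = assms(13,14)
    and X = assms(15)
  interpret T: Ext_pseudo_metric T dT by (rule T)
  interpret E: Ext_pseudo_metric E dE by (rule E)
  interpret prob_space P by (rule assms(4))
  obtain M where M: "\<And>m. M m \<ge> 0" "\<And>m. kolmogorov_condition P T dT E dE X (p m) (q m) (M m)"
    using assms(16) by metis
  have TnT: "Tn n \<subseteq> T" for n using openin_subset[OF openT] by simp
  have XE: "X t \<omega> \<in> E" if "t \<in> T" "\<omega> \<in> space P" for t \<omega>
    using process_value_in_space[OF X that] by simp

  \<comment> \<open>The countable dense set and the approximating points\<close>
  have "\<forall>n k. \<exists>C. finite C \<and> is_cover dT (ennreal ((1/2) ^ k)) (Tn n) C"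
    using exists_dyadic_cover[OF T TnT bcn d] by blast
  then obtain V where V: "\<And>n k. finite (V n k)" "\<And>n k. is_cover dT (ennreal ((1/2) ^ k)) (Tn n) (V n k)"
    by metis
  define D where "D = (\<Union>n k. V n k)"
  have D: "countable D" unfolding D_def using V(1) by (intro countable_UN) (auto intro: countable_finite)
  \<comment> \<open>Approximating \<open>t\<close> inside the first \<open>Tn n\<close> that
    contains it makes \<open>u t k\<close> independent of \<open>n\<close>; by monotonicity it lies
    in every \<open>Tn n\<close> containing \<open>t\<close>.\<close>
  define first where "first t = (LEAST n. t \<in> Tn n)" for t
  have first: "t \<in> Tn (first t)" if "t \<in> T" for t
    unfolding first_def using cover that by (auto intro: LeastI)
  have "\<exists>v\<in>V (first t) k. dT v t \<le> ennreal ((1/2) ^ k)" if "t \<in> T" for t k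
    using V(2)[of k "first t"] first[OF that] by (auto simp: is_cover_def)
  then have "\<forall>t k. \<exists>v. t \<in> T \<longrightarrow> v \<in> V (first t) k \<and> dT v t \<le> ennreal ((1/2) ^ k)" by blast
  then obtain u where u: "\<And>t k. t \<in> T \<Longrightarrow> u t k \<in> V (first t) k"
      "\<And>t k. t \<in> T \<Longrightarrow> dT (u t k) t \<le> ennreal ((1/2) ^ k)" by metis
  have uD: "u t k \<in> D \<inter> Tn n" if "t \<in> Tn n" for t k n
  proof -
    have "first t \<le> n" unfolding first_def using that by (rule Least_le)
    moreover have "t \<in> T" using that TnT by blast
    moreover from this have "u t k \<in> Tn (first t)"
      using u(1)[of t k] V(2)[of k "first t"] by (auto simp: is_cover_def)
    ultimately show ?thesis using u(1)[of t k] incseqD[OF inc] by (auto simp: D_def)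
  qed
  have uT: "u t k \<in> T" if "t \<in> T" for t k using uD[OF first[OF that]] TnT by blast

  \<comment> \<open>One null set for all rational orders and all \<open>Tn n\<close>\<close>
  define G where "G = {\<gamma> \<in> \<rat>. 0 < \<gamma> \<and> (\<exists>m. \<gamma> < (q m - d) / p m)}"
  have G: "countable G" unfolding G_def by (rule countable_subset[OF _ countable_rat]) auto
  define good where "good \<omega> \<longleftrightarrow>
    (\<forall>n. \<forall>\<gamma>\<in>G. dyadic_holder dT dE (2 powr - \<gamma>) (D \<inter> Tn n) (\<lambda>t. X t \<omega>))" for \<omega>
  have "AE \<omega> in P. dyadic_holder dT dE (2 powr - \<gamma>) (D \<inter> Tn n) (\<lambda>t. X t \<omega>)" if \<gamma>: "\<gamma> \<in> G" for n \<gamma>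
  proof -
    obtain m where m: "0 < \<gamma>" "\<gamma> < (q m - d) / p m" using \<gamma> by (auto simp: G_def)
    show ?thesis
      by (rule AE_dyadic_holder_on_countable[OF T E X M(2) p q(1) M(1) d m TnT bcn])
        (use D in auto)
  qed
  then have "AE \<omega> in P. good \<omega>"
    unfolding good_def using G by (simp add: AE_all_countable AE_ball_countable)
  \<comment> \<open>A measurable null set containing the bad event: making \<open>Y\<close> constant
    on it does not disturb measurability.\<close>
  then obtain N where N: "{\<omega> \<in> space P. \<not> good \<omega>} \<subseteq> N" "emeasure P N = 0" "N \<in> sets P"
    by (rule AE_E)

  \<comment> \<open>The modification and its measurability\<close>
  define x0 where "x0 = (SOME x. x \<in> E)"
  \<comment> \<open>\<open>E\<close> may be empty if \<open>T\<close> is; otherwise any value of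
    \<open>X\<close> shows that it is not.\<close>
  have x0: "x0 \<in> E" if "t \<in> T" for t
    unfolding x0_def using XE[OF that] not_empty by (metis ex_in_conv someI)
  define conv where "conv t \<omega> x \<longleftrightarrow> x \<in> E \<and> (\<lambda>k. dE (X (u t k) \<omega>) x) \<longlonglongrightarrow> 0" for t \<omega> x
  define Y where "Y t \<omega> = (if \<omega> \<in> N then x0 else if conv t \<omega> (X t \<omega>) then X t \<omega> else (SOME x. conv t \<omega> x))" for t \<omega>
  have goodD: "good \<omega>" if "\<omega> \<in> space P" "\<omega> \<notin> N" for \<omega> using N(1) that by blast
  have Y_conv: "conv t \<omega> (Y t \<omega>)" if t: "t \<in> T" and \<omega>: "\<omega> \<in> space P" "\<omega> \<notin> N" for t \<omega>
  proof -
    \<comment> \<open>Any order in \<open>G\<close> yields convergence; the pair with index 0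
      supplies one.\<close>
    have "0 < (q 0 - d) / p 0" using p[of 0] q(2)[of 0] by simp
    then obtain \<gamma> where \<gamma>: "\<gamma> \<in> \<rat>" "0 < \<gamma>" "\<gamma> < (q 0 - d) / p 0" using Rats_dense_in_real by blast
    then have "\<gamma> \<in> G" by (auto simp: G_def)
    then have holder: "dyadic_holder dT dE (2 powr - \<gamma>) (D \<inter> Tn (first t)) (\<lambda>t. X t \<omega>)"
      using goodD[OF \<omega>] by (auto simp: good_def)
    have "\<exists>x. conv t \<omega> x"
    proof (rule dyadic_holder_limit_exists[OF T E complete _ _ _ _ holder uD[OF first[OF t]] t u(2)[OF t]])
      show "(\<lambda>t. X t \<omega>) \<in> T \<rightarrow> E" using XE \<omega> by auto
      show "2 powr - \<gamma> < 1" using \<gamma> by (simp add: powr_less_one)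
    qed (use TnT in \<open>auto simp: conv_def\<close>)
    then have "conv t \<omega> (SOME x. conv t \<omega> x)" by (rule someI_ex)
    then show ?thesis using \<omega> by (simp add: Y_def)
  qed
  have Y_E: "Y t \<omega> \<in> E" if "t \<in> T" "\<omega> \<in> space P" for t \<omega>
    using Y_conv[OF that] x0[OF that(1)] by (cases "\<omega> \<in> N") (auto simp: conv_def Y_def)

  have Y_meas: "Y t \<in> measurable P (borel_of E.mtopology)" if t: "t \<in> T" for t
  proof (rule E.measurable_limit)
    show "(\<lambda>\<omega>. if \<omega> \<in> N then x0 else X (u t k) \<omega>) \<in> measurable P (borel_of E.mtopology)" for k
      using X uT[OF t, of k] x0[OF t] N(3)
      by (intro measurable_If_set) (auto simp: stochastic_process_def)
    show "Y t \<in> space P \<rightarrow> E" using Y_E[OF t] by auto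
    show "(\<lambda>k. dE (if \<omega> \<in> N then x0 else X (u t k) \<omega>) (Y t \<omega>)) \<longlonglongrightarrow> 0" if "\<omega> \<in> space P" for \<omega>
    proof (cases "\<omega> \<in> N")
      case True
      then show ?thesis using x0[OF t] by (simp add: Y_def E.refl)
    next
      case False
      then show ?thesis using Y_conv[OF t that] by (simp add: conv_def)
    qed
  qed
  have Y_eq: "AE \<omega> in P. X t \<omega> = Y t \<omega>" if t: "t \<in> T" for t
  proof -
    have "AE \<omega> in P. (\<lambda>k. dE (X (u t k) \<omega>) (X t \<omega>)) \<longlonglongrightarrow> 0"
      by (rule AE_tendsto_of_geometric_approx[OF E M(2) p q(1) M(1) uT[OF t] t u(2)[OF t]])
    moreover have "AE \<omega> in P. \<omega> \<notin> N" using N(2,3) by (intro AE_not_in null_setsI)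
    ultimately show ?thesis
      using AE_space
    proof eventually_elim
      case (elim \<omega>)
      then show ?case using XE[OF t] by (simp add: Y_def conv_def)
    qed
  qed

  \<comment> \<open>Local Hoelder continuity of every path\<close>
  have Y_holder: "locally_holder T dT dE \<gamma> (\<lambda>t. Y t \<omega>)"
    if \<omega>: "\<omega> \<in> space P" and \<gamma>: "0 < \<gamma>" "ereal \<gamma> < (SUP m. ereal ((q m - d) / p m))" for \<omega> \<gamma>
    unfolding locally_holder_def
  proof
    fix t assume t: "t \<in> T"
    \<comment> \<open>Radius 1/4 keeps any two points of \<open>U\<close> within the distance 1/2
      allowed by \<open>holder_of_dyadic_approximation\<close>.\<close>
    define U where "U = Tn (first t) \<inter> T.mball t (ennreal (1/4))"
    have U: "openin T.mtopology U" unfolding U_def by (intro openin_Int openT T.openin_mball)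
    have tU: "t \<in> U" unfolding U_def using first[OF t] T.mem_mball_self[OF t, of "ennreal (1/4)"] by simp
    have UT: "U \<subseteq> T" using openin_subset[OF U] by simp
    have U_close: "dT r s \<le> ennreal (1/2)" if "r \<in> U" "s \<in> U" for r s
    proof -
      have rs: "r \<in> T" "s \<in> T" "dT t r < ennreal (1/4)" "dT t s < ennreal (1/4)"
        using that by (auto simp: U_def T.mball_def)
      have "dT r s \<le> dT t r + dT t s" using T.triangle[of r t s] rs t by (simp add: T.commute)
      also have "\<dots> \<le> ennreal (1/4) + ennreal (1/4)" using rs by (intro add_mono less_imp_le)
      also have "\<dots> = ennreal (1/2)" by (subst ennreal_plus[symmetric]) simp_all
      finally show ?thesis .
    qed
    have "\<exists>C\<ge>0. \<forall>r\<in>U. \<forall>s\<in>U. dE (Y r \<omega>) (Y s \<omega>) \<le> ennreal C * (dT r s epowr \<gamma>)"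
    proof (cases "\<omega> \<in> N")
      case True
      then show ?thesis using x0[OF t] by (intro exI[of _ 0]) (simp add: Y_def E.refl)
    next
      case False
      \<comment> \<open>An order below the supremum is below one of the quotients, and a rational
        order in between belongs to \<open>G\<close>.\<close>
      obtain m where "\<gamma> < (q m - d) / p m" using \<gamma>(2) by (auto simp: less_SUP_iff)
      then obtain \<gamma>' where \<gamma>': "\<gamma>' \<in> \<rat>" "\<gamma> < \<gamma>'" "\<gamma>' < (q m - d) / p m"
        using Rats_dense_in_real by blast
      then have "\<gamma>' \<in> G" using \<gamma>(1) by (auto simp: G_def)
      then have "dyadic_holder dT dE (2 powr - \<gamma>') (D \<inter> Tn (first t)) (\<lambda>t. X t \<omega>)"
        using goodD[OF \<omega> False] by (auto simp: good_def)
      then have holder: "dyadic_holder dT dE (2 powr - \<gamma>) (D \<inter> Tn (first t)) (\<lambda>t. X t \<omega>)"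
        by (rule dyadic_holder_mono) (use \<gamma>'(2) in simp_all)
      obtain C where "0 \<le> C" "\<And>r s. r \<in> U \<Longrightarrow> s \<in> U \<Longrightarrow> dT r s \<le> ennreal (1/2) \<Longrightarrow>
          dE (Y r \<omega>) (Y s \<omega>) \<le> ennreal C * (dT r s epowr \<gamma>)"
      proof (rule holder_of_dyadic_approximation[OF T E _ _ UT _ \<gamma>(1) holder, of "\<lambda>t. Y t \<omega>" u])
        show "(\<lambda>t. X t \<omega>) \<in> T \<rightarrow> E" using XE \<omega> by auto
        show "D \<inter> Tn (first t) \<subseteq> T" using TnT by blast
        show "(\<lambda>t. Y t \<omega>) \<in> U \<rightarrow> E" using Y_E \<omega> UT by auto
        show "u s k \<in> D \<inter> Tn (first t)" if "s \<in> U" for s k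
          using uD[of s "first t" k] that by (simp add: U_def)
        show "dT (u s k) s \<le> ennreal ((1/2) ^ k)" if "s \<in> U" for s k using u(2) that UT by blast
        show "(\<lambda>k. dE (X (u s k) \<omega>) (Y s \<omega>)) \<longlonglongrightarrow> 0" if "s \<in> U" for s
          using Y_conv[of s \<omega>] that UT \<omega> False by (auto simp: conv_def)
      qed blast
      then show ?thesis using U_close by blast
    qed
    then show "\<exists>U C. openin T.mtopology U \<and> t \<in> U \<and> 0 \<le> C \<and>
        (\<forall>r\<in>U. \<forall>s\<in>U. dE (Y r \<omega>) (Y s \<omega>) \<le> ennreal C * (dT r s epowr \<gamma>))"
      using U tU by blast
  qed
  show ?thesis
    using Y_meas Y_eq Y_holder
    by (intro exI[of _ Y]) (simp add: modification_def stochastic_process_def)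
qed

end
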